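(* Let $\mathcal{W}\subset\mathbb{R}^m$ be a bounded convex domain, $\tilde I$ a bounded interval, and $\mathscr{G}:\mathcal{W}\to L^\infty(\tilde I)$, $\omega\mapsto\tilde g(\cdot,\omega)$. Suppose $\mathscr{G}$ extends to a holomorphic (Banach-space-valued) map, bounded on compact subsets, on an open set $\mathcal{U}\subset\mathbb{C}^m$ containing $\overline{\mathcal{W}}$. Let $\widetilde{\mathcal{D}}=\mathscr{G}(\mathcal{W})$. Then there are constants $C_4,C_5>0$ and $C>0$ independent of $n$ such that for all $n\ge1$ $$d_n(\widetilde{\mathcal{D}})_{L^\infty(\tilde I)}\le Ce^{-C_4n^{1/m}},\qquad \varepsilon_n(B_1(\widetilde{\mathcal{D}}))_{L^\infty(\tilde I)}\le Ce^{-C_5n^{1/(m+1)}}.$$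
   Context: Kolmogorov $n$-width: $d_n(F)_X=\inf_{\dim V=n}\sup_{f\in F}\inf_{g\in V}\|f-g\|_X$. Entropy numbers: $\varepsilon_n(F)_X=\inf\{\varepsilon>0: F\text{ is covered by }2^n\text{ balls of radius }\varepsilon\text{ in }X\}$. $B_1(\widetilde{\mathcal{D}})$ is the closure in $X$ of $\{\sum_{j=1}^k c_jg_j: k\in\mathbb{N}, g_j\in\widetilde{\mathcal{D}}, \sum_j|c_j|\le1\}$. *)

theory Defs
  imports "HOL-Analysis.Analysis" "HOL-Probability.Probability"
begin

text \<open>Essential-sup (semi)norm of L-infinity on a set I of reals (Lebesgue measure).
  Functions are handled as representatives; all notions below only depend on
  them through this seminorm, i.e. they are notions on the quotient L-infinity(I).\<close>
definition Linf_norm :: "real set \<Rightarrow> (real \<Rightarrow> 'a::real_normed_vector) \<Rightarrow> ereal" where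
  "Linf_norm I f = esssup (lebesgue_on I) (\<lambda>x. ereal (norm (f x)))"

definition Linf_space :: "real set \<Rightarrow> (real \<Rightarrow> 'a::real_normed_vector) set" where
  "Linf_space I = {f. f \<in> borel_measurable (lebesgue_on I) \<and> Linf_norm I f < \<infinity>}"

text \<open>Kolmogorov n-width in L-infinity(I) (real-valued functions): infimum over
  subspaces spanned by n elements of L-infinity(I) (dimension at most n; equivalent
  to dimension exactly n since L-infinity(I) is infinite dimensional and the width is
  monotone in the dimension).\<close>
definition kolmogorov_width :: "real set \<Rightarrow> nat \<Rightarrow> (real \<Rightarrow> real) set \<Rightarrow> ereal" where
  "kolmogorov_width I n F =
     (INF b \<in> {b :: nat \<Rightarrow> real \<Rightarrow> real. \<forall>i<n. b i \<in> Linf_space I}.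
        SUP f \<in> F. INF c :: nat \<Rightarrow> real.
           Linf_norm I (\<lambda>x. f x - (\<Sum>i<n. c i * b i x)))"

definition entropy_number :: "real set \<Rightarrow> nat \<Rightarrow> (real \<Rightarrow> real) set \<Rightarrow> ereal" where
  "entropy_number I n F =
     Inf (ereal ` {\<epsilon>::real. \<epsilon> > 0 \<and>
        (\<exists>c :: nat \<Rightarrow> real \<Rightarrow> real. (\<forall>i<2^n. c i \<in> Linf_space I) \<and>
           (\<forall>f\<in>F. \<exists>i<2^n. Linf_norm I (\<lambda>x. f x - c i x) \<le> ereal \<epsilon>))})"

definition l1_combinations :: "(real \<Rightarrow> real) set \<Rightarrow> (real \<Rightarrow> real) set" where
  "l1_combinations D = {(\<lambda>x. \<Sum>j<k. c j * g j x) | (k::nat) (c::nat \<Rightarrow> real) (g::nat \<Rightarrow> real \<Rightarrow> real).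
      (\<forall>j<k. g j \<in> D) \<and> (\<Sum>j<k. \<bar>c j\<bar>) \<le> 1}"

definition B1 :: "real set \<Rightarrow> (real \<Rightarrow> real) set \<Rightarrow> (real \<Rightarrow> real) set" where
  "B1 I D = {f \<in> Linf_space I. \<forall>\<epsilon>>0. \<exists>h\<in>l1_combinations D.
      Linf_norm I (\<lambda>x. f x - h x) < ereal \<epsilon>}"

definition cvec :: "real^'m \<Rightarrow> complex^'m" where
  "cvec w = (\<chi> i. complex_of_real (w $ i))"

definition Linf_holomorphic_on ::
    "real set \<Rightarrow> (complex^'m \<Rightarrow> real \<Rightarrow> complex) \<Rightarrow> (complex^'m) set \<Rightarrow> bool" where
  "Linf_holomorphic_on I G U \<longleftrightarrow>
     (\<forall>z\<in>U. G z \<in> Linf_space I \<and>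
        (\<exists>L :: complex^'m \<Rightarrow> real \<Rightarrow> complex.
           (\<forall>v. L v \<in> Linf_space I) \<and>
           (\<forall>v w. L (v + w) = (\<lambda>x. L v x + L w x)) \<and>
           (\<forall>a v. L (a *s v) = (\<lambda>x. a * L v x)) \<and>
           (\<forall>\<epsilon>>0. \<exists>\<delta>>0. \<forall>h. norm h < \<delta> \<longrightarrow> z + h \<in> U \<longrightarrow>
              Linf_norm I (\<lambda>x. G (z + h) x - G z x - L h x) \<le> ereal (\<epsilon> * norm h))))"

end

theory Submission
  imports Defs "HOL-Complex_Analysis.Cauchy_Integral_Formula"
begin

text \<open>A holomorphic function on a disc of radius \<open>R\<close> is approximated on the concentric disc of radius
  \<open>R/4\<close> with error \<open>O(2\<^sup>-\<^sup>N)\<close> by interpolation at the \<open>N\<close>-th roots of unity scaled to radius \<open>R/2\<close>, with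
  uniformly bounded weights; tensor products extend this to polydiscs in \<open>m\<close> variables with
  \<open>N\<^sup>m\<close> nodes. The scalar estimate is applied to the averages \<open>z \<mapsto> \<integral>\<^sub>A G(z)\<close> over
  measurable \<open>A \<subseteq> I\<close>; since these averages determine the essential supremum, \<open>G(z)\<close> itself is within
  \<open>O(2\<^sup>-\<^sup>N)\<close> of a bounded combination of finitely many of its own values, without any vector-valued
  integration. Finitely many polydiscs cover the closure of \<open>W\<close>, which gives the width bound with
  \<open>n\<close> of order \<open>N\<^sup>m\<close>. Rounding the coefficients of these combinations to multiples of \<open>2\<^sup>-\<^sup>N\<close> leaves
  \<open>2^O(N\<^sup>m\<^sup>+\<^sup>1)\<close> centres, which gives the entropy bound.\<close>

section \<open>Interpolation at roots of unity\<close>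

definition unity_root :: "nat \<Rightarrow> nat \<Rightarrow> complex" where
  "unity_root N j = cis (2 * pi * real j / real N)"

lemma norm_unity_root [simp]: "norm (unity_root N j) = 1"
  by (simp add: unity_root_def)

lemma unity_root_nonzero [simp]: "unity_root N j \<noteq> 0"
  by (simp add: unity_root_def)

text \<open>Both sides are \<open>cis (2 * pi * j * k / N)\<close>. The symmetry in \<open>j\<close>
  and \<open>k\<close> lets a sum over the nodes be read as a geometric sum in a fixed root.\<close>

lemma unity_root_power_commute: "unity_root N j ^ k = unity_root N k ^ j"
  by (simp add: unity_root_def Complex.DeMoivre mult_ac)

lemma unity_root_power_self: "N > 0 \<Longrightarrow> unity_root N k ^ N = 1"
proof -
  assume "N > 0"
  then have "unity_root N k ^ N = cis (2 * pi * real k)"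
    by (simp add: unity_root_def Complex.DeMoivre)
  also have "\<dots> = 1"
    by (metis Ints_of_nat cis_multiple_2pi)
  finally show ?thesis .
qed

lemma unity_root_inj:
  assumes "k < N" "l < N" "unity_root N k = unity_root N l"
  shows "k = l"
proof -
  have "\<exists>n::int. 2 * pi * real k / real N = 2 * pi * real l / real N + 2 * pi * n"
    using assms(3) sin_cos_eq_iff[of "2 * pi * real k / real N" "2 * pi * real l / real N"]
    by (auto simp: unity_root_def complex_eq_iff mult.commute)
  then obtain n :: int where "2 * pi * real k / real N = 2 * pi * real l / real N + 2 * pi * n" ..
  then have "2 * pi * (real k) = 2 * pi * (real l + real N * n)"
    using assms by (simp add: field_simps)
  then have "real k = real l + real N * n"
    by simp
  then have e: "int k = int l + int N * n"
    by (metis (mono_tags, lifting) of_int_add of_int_eq_iff of_int_mult of_int_of_nat_eq)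
  then have "int k mod int N = int l mod int N"
    by simp
  then show ?thesis
    using assms by simp
qed

text \<open>Discrete Fourier orthogonality. For \<open>k \<noteq> l\<close> the summands are the
  powers of an \<open>N\<close>-th root of unity different from 1, so their geometric sum
  vanishes.\<close>

lemma sum_unity_root_orthogonal:
  assumes "k < N" "l < N"
  shows "(\<Sum>j<N. unity_root N j ^ k / unity_root N j ^ l) = (if k = l then of_nat N else 0)"
proof (cases "k = l")
  case False
  define x where "x = unity_root N k / unity_root N l"
  have "x \<noteq> 1"
    using unity_root_inj[OF assms] False by (auto simp: x_def)
  moreover have "x ^ N = 1"
    using assms by (simp add: x_def power_divide unity_root_power_self)
  ultimately have "(\<Sum>j<N. x ^ j) = 0"
    by (simp add: geometric_sum)
  then show ?thesis
    using False by (simp add: x_def power_divide unity_root_power_commute[of N _ k]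
        unity_root_power_commute[of N _ l])
qed simp

text \<open>The value at \<open>u\<close> of the Lagrange basis polynomial for the node
  \<open>unity_root N j\<close>, written as a geometric sum instead of a product of differences. In
  this form it is easy to bound for small \<open>u\<close>; at \<open>N = 0\<close> it is 0.\<close>

definition interp_weight :: "nat \<Rightarrow> complex \<Rightarrow> nat \<Rightarrow> complex" where
  "interp_weight N u j = (\<Sum>k<N. (u / unity_root N j) ^ k) / of_nat N"

text \<open>Expanding the weights and swapping the sums leaves inner sums over the nodes, and
  orthogonality keeps only the one with \<open>l = k\<close>.\<close>

lemma interp_weight_exact:
  assumes "k < N"
  shows "(\<Sum>j<N. interp_weight N u j * unity_root N j ^ k) = u ^ k"
proof -
  have "(\<Sum>j<N. interp_weight N u j * unity_root N j ^ k)
      = (\<Sum>j<N. \<Sum>l<N. u ^ l / of_nat N * (unity_root N j ^ k / unity_root N j ^ l))"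
    unfolding interp_weight_def sum_divide_distrib sum_distrib_right
    by (intro sum.cong) (simp_all add: power_divide)
  also have "\<dots> = (\<Sum>l<N. u ^ l / of_nat N * (\<Sum>j<N. unity_root N j ^ k / unity_root N j ^ l))"
    by (subst sum.swap) (simp add: sum_distrib_left)
  also have "\<dots> = (\<Sum>l<N. if l = k then u ^ l else 0)"
    using assms by (intro sum.cong) (auto simp: sum_unity_root_orthogonal)
  also have "\<dots> = u ^ k"
    using assms by simp
  finally show ?thesis .
qed

text \<open>The nodes have modulus 1, so the defining sum is dominated by a geometric series of
  ratio 1/2.\<close>

lemma norm_interp_weight_le:
  assumes "norm u \<le> 1/2"
  shows "norm (interp_weight N u j) \<le> 2 / real N"
proof -
  have "norm (\<Sum>k<N. (u / unity_root N j) ^ k) \<le> (\<Sum>k<N. (1/2) ^ k)"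
    using assms by (intro sum_norm_le) (auto simp: norm_power norm_divide intro: power_mono)
  also have "\<dots> \<le> (2::real)"
    by (simp add: geometric_sum)
  finally show ?thesis
    by (simp add: interp_weight_def norm_divide divide_right_mono)
qed

lemma norm_interp_weight_le_2:
  assumes "norm u \<le> 1/2"
  shows "norm (interp_weight N u j) \<le> 2"
proof (cases "N = 0")
  case False
  then have "2 / real N \<le> 2"
    by (simp add: field_simps)
  then show ?thesis
    using norm_interp_weight_le[OF assms, of N j] by linarith
qed (simp add: interp_weight_def)

text \<open>A Lebesgue constant independent of \<open>N\<close>. There is no growth in
  \<open>N\<close> because evaluation stays in the disc of half the node radius.\<close>

lemma sum_norm_interp_weight_le:
  assumes "norm u \<le> 1/2"
  shows "(\<Sum>j<N. norm (interp_weight N u j)) \<le> 2"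
proof -
  have "(\<Sum>j<N. norm (interp_weight N u j)) \<le> (\<Sum>j<N. 2 / real N)"
    by (intro sum_mono norm_interp_weight_le assms)
  also have "\<dots> \<le> 2"
    by simp
  finally show ?thesis .
qed

lemma norm_rescale_le_half:
  fixes v :: complex
  assumes "norm v \<le> R / 4" "R > 0"
  shows "norm (v / of_real (R/2)) \<le> 1/2"
  unfolding norm_divide using assms by (simp add: divide_simps)

text \<open>Interpolation reproduces the powers below \<open>N\<close>, so only the Taylor tail
  contributes. Cauchy's inequality bounds the coefficients by \<open>B / R ^ k\<close>, while
  \<open>z\<close> and the nodes lie within \<open>R/2\<close> of \<open>p\<close>, so the tail is
  geometric with ratio 1/2.\<close>

lemma interp_error:
  assumes holo: "f holomorphic_on cball p R" and "R > 0"
    and bound: "\<And>t. t \<in> cball p R \<Longrightarrow> norm (f t) \<le> B"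
    and z: "norm (z - p) \<le> R / 4"
  shows "norm (f z - (\<Sum>j<N. interp_weight N ((z - p) / of_real (R/2)) j *
            f (p + of_real (R/2) * unity_root N j))) \<le> 6 * B * (1/2) ^ N"
proof -
  define u where "u = (z - p) / of_real (R/2)"
  define t where "t j = p + of_real (R/2) * unity_root N j" for j
  define a where "a k = (deriv ^^ k) f p / fact k" for k
  \<comment> \<open>The interpolation error of the \<open>k\<close>-th monomial; the error for
    \<open>f\<close> is the series of the \<open>a k * e k\<close>.\<close>
  define e where "e k = (z - p) ^ k - (\<Sum>j<N. interp_weight N u j * (t j - p) ^ k)" for k
  have u: "norm u \<le> 1/2" and zp: "z - p = of_real (R/2) * u"
    unfolding u_def using norm_rescale_le_half[OF z \<open>R > 0\<close>] \<open>R > 0\<close> by auto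
  have "B \<ge> 0"
    using order_trans[OF norm_ge_zero bound[of p]] \<open>R > 0\<close> by simp
  have "f holomorphic_on ball p R"
    using holo by (rule holomorphic_on_subset) auto
  then have series: "(\<lambda>k. a k * (w - p) ^ k) sums f w" if "w \<in> ball p R" for w
    unfolding a_def using holomorphic_power_series that by blast
  have a: "norm (a k) \<le> B / R ^ k" for k
  proof -
    have "norm ((deriv ^^ k) f p) \<le> fact k * B / R ^ k"
      using \<open>f holomorphic_on ball p R\<close> holomorphic_on_imp_continuous_on[OF holo] \<open>R > 0\<close>
      by (rule Cauchy_inequality) (auto intro!: bound simp: dist_norm)
    then show ?thesis
      by (simp add: a_def norm_divide field_simps)
  qed
  have "(\<lambda>k. a k * (z - p) ^ k - (\<Sum>j<N. interp_weight N u j * (a k * (t j - p) ^ k)))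
      sums (f z - (\<Sum>j<N. interp_weight N u j * f (t j)))"
    using z \<open>R > 0\<close>
    by (intro sums_diff sums_sum sums_mult series)
       (auto simp: t_def dist_norm norm_mult norm_minus_commute)
  then have sums: "(\<lambda>k. a k * e k) sums (f z - (\<Sum>j<N. interp_weight N u j * f (t j)))"
    by (simp add: e_def algebra_simps sum_distrib_left)
  have e0: "e k = 0" if "k < N" for k
  proof -
    have "(\<Sum>j<N. interp_weight N u j * (t j - p) ^ k)
        = of_real (R/2) ^ k * (\<Sum>j<N. interp_weight N u j * unity_root N j ^ k)"
      by (simp add: t_def power_mult_distrib power_divide sum_distrib_left mult_ac)
    then show ?thesis
      unfolding e_def zp interp_weight_exact[OF that] power_mult_distrib by simp
  qed
  \<comment> \<open>The factor 3 is 1 for the monomial at \<open>z\<close> plus 2 for the total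
    weight of its values at the nodes.\<close>
  have e_le: "norm (e k) \<le> 3 * (R/2) ^ k" for k
  proof -
    have "norm (\<Sum>j<N. interp_weight N u j * (t j - p) ^ k)
        \<le> (\<Sum>j<N. norm (interp_weight N u j) * (R/2) ^ k)"
      using \<open>R > 0\<close> by (intro sum_norm_le) (simp add: t_def norm_mult norm_power)
    also have "\<dots> \<le> 2 * (R/2) ^ k"
      unfolding sum_distrib_right[symmetric] using \<open>R > 0\<close>
      by (intro mult_right_mono sum_norm_interp_weight_le u) auto
    finally have "norm (\<Sum>j<N. interp_weight N u j * (t j - p) ^ k) \<le> 2 * (R/2) ^ k" .
    moreover have "norm ((z - p) ^ k) \<le> (R/2) ^ k"
      unfolding norm_power using z \<open>R > 0\<close> by (intro power_mono) auto
    ultimately show ?thesis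
      unfolding e_def using norm_triangle_ineq4[of "(z - p) ^ k"] by (smt (verit))
  qed
  have ae: "norm (a k * e k) \<le> (if k < N then 0 else 3 * B * (1/2) ^ k)" for k
  proof -
    have "norm (a k * e k) \<le> B / R ^ k * (3 * (R/2) ^ k)"
      unfolding norm_mult using \<open>R > 0\<close> \<open>B \<ge> 0\<close> by (intro mult_mono a e_le) auto
    also have "\<dots> = 3 * B * (1/2) ^ k"
      using \<open>R > 0\<close> by (simp add: power_divide)
    finally show ?thesis
      by (simp add: e0)
  qed
  \<comment> \<open>The tail starting at index \<open>N\<close> is a geometric series with first
    term \<open>3 * B * (1/2) ^ N\<close> and ratio 1/2, hence twice its first term.\<close>
  have geo: "(\<lambda>k. if k < N then 0 else 3 * B * (1/2) ^ k) sums (6 * B * (1/2) ^ N)"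
  proof -
    have "(\<lambda>k. 3 * B * (1/2) ^ N * (1/2) ^ k) sums (3 * B * (1/2) ^ N * (1 / (1 - 1/2)))"
      by (intro sums_mult geometric_sums) auto
    then have "(\<lambda>k. if k + N < N then 0 else 3 * B * (1/2) ^ (k + N)) sums (6 * B * (1/2) ^ N)"
      by (simp add: power_add mult_ac)
    then show ?thesis
      by (subst (asm) sums_iff_shift) simp
  qed
  have "norm (\<Sum>k. a k * e k) \<le> (\<Sum>k. if k < N then 0 else 3 * B * (1/2) ^ k)"
    by (rule norm_suminf_le[OF ae sums_summable[OF geo]])
  then show ?thesis
    using sums_unique[OF sums] sums_unique[OF geo] by (simp add: u_def t_def)
qed

section \<open>Tensor-product interpolation on polydiscs\<close>

definition interp_node :: "nat \<Rightarrow> complex^'m \<Rightarrow> real \<Rightarrow> 'm set \<Rightarrow> complex^'m \<Rightarrow> ('m \<Rightarrow> nat) \<Rightarrow> complex^'m" where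
  "interp_node N p R S z \<beta> =
     (\<chi> i. if i \<in> S then p $ i + of_real (R/2) * unity_root N (\<beta> i) else z $ i)"

text \<open>As in \<open>interp_node\<close>, only the coordinates in \<open>S\<close> are
  interpolated and the others are kept from \<open>z\<close>. The partial form allows an induction
  that adds one coordinate at a time.\<close>

definition tensor_weight :: "nat \<Rightarrow> complex^'m \<Rightarrow> real \<Rightarrow> 'm set \<Rightarrow> complex^'m \<Rightarrow> ('m \<Rightarrow> nat) \<Rightarrow> complex" where
  "tensor_weight N p R S z \<beta> = (\<Prod>i\<in>S. interp_weight N ((z $ i - p $ i) / of_real (R/2)) (\<beta> i))"

definition update_coord :: "complex^'m \<Rightarrow> 'm \<Rightarrow> complex \<Rightarrow> complex^'m" where
  "update_coord z i t = (\<chi> j. if j = i then t else z $ j)"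

lemma update_coord_nth [simp]: "update_coord z i t $ j = (if j = i then t else z $ j)"
  by (simp add: update_coord_def)

lemma update_coord_self [simp]: "update_coord z i (z $ i) = z"
  by (simp add: vec_eq_iff)

definition polydisc :: "complex^'m \<Rightarrow> real \<Rightarrow> (complex^'m) set" where
  "polydisc p R = {z. \<forall>i. norm (z $ i - p $ i) \<le> R}"

lemma sum_PiE_insert:
  assumes "i \<notin> S"
  shows "sum h (PiE (insert i S) (\<lambda>_. A)) = (\<Sum>j\<in>A. \<Sum>\<beta>\<in>PiE S (\<lambda>_. A). h (\<beta>(i := j)))"
  unfolding PiE_insert_eq sum.cartesian_product
  by (subst sum.reindex[OF inj_combinator[OF assms]]) (simp add: comp_def case_prod_unfold)

text \<open>Induction on the set of interpolated coordinates. A new coordinate contributes its own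
  error \<open>6 * B * (1/2) ^ N\<close>, and the previous error is at most doubled because the
  weights have total modulus at most 2. The recursion \<open>E' = 6 * B * (1/2) ^ N + 2 * E\<close>
  produces the factor \<open>2 ^ card S - 1\<close>.\<close>

lemma tensor_interp_error:
  fixes F :: "complex^'m \<Rightarrow> complex"
  assumes "finite S" and "R > 0"
    and holo: "\<And>z i. z \<in> polydisc p R \<Longrightarrow> (\<lambda>t. F (update_coord z i t)) holomorphic_on cball (p $ i) R"
    and bound: "\<And>z. z \<in> polydisc p R \<Longrightarrow> norm (F z) \<le> B"
    and "z \<in> polydisc p R" and "\<And>i. i \<in> S \<Longrightarrow> norm (z $ i - p $ i) \<le> R / 4"
  shows "norm (F z - (\<Sum>\<beta>\<in>PiE S (\<lambda>_. {..<N}). tensor_weight N p R S z \<beta> * F (interp_node N p R S z \<beta>)))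
           \<le> 6 * (2 ^ card S - 1) * B * (1/2) ^ N"
  using \<open>finite S\<close> assms(5,6)
proof (induction S arbitrary: z rule: finite_induct)
  case empty
  have "interp_node N p R {} z (\<lambda>x. undefined) = z"
    by (simp add: interp_node_def)
  then show ?case
    by (simp add: tensor_weight_def)
next
  case (insert i S)
  define u where "u = (z $ i - p $ i) / of_real (R/2)"
  define t where "t j = p $ i + of_real (R/2) * unity_root N j" for j
  define P where "P z = (\<Sum>\<beta>\<in>PiE S (\<lambda>_. {..<N}). tensor_weight N p R S z \<beta> * F (interp_node N p R S z \<beta>))" for z
  define E where "E = 6 * (2 ^ card S - 1) * B * (1/2) ^ N"
  have "norm u \<le> 1/2"
    unfolding u_def using insert.prems(2)[of i] \<open>R > 0\<close> by (intro norm_rescale_le_half) auto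
  have "tensor_weight N p R (insert i S) z (\<beta>(i := j))
      = interp_weight N u j * tensor_weight N p R S (update_coord z i (t j)) \<beta>" for \<beta> j
    unfolding tensor_weight_def using insert.hyps
    by (subst prod.insert) (auto simp: u_def intro!: arg_cong2[where f = "(*)"] prod.cong)
  moreover have "interp_node N p R (insert i S) z (\<beta>(i := j))
      = interp_node N p R S (update_coord z i (t j)) \<beta>" for \<beta> j
    using insert.hyps by (auto simp: interp_node_def t_def vec_eq_iff)
  ultimately have split: "(\<Sum>\<beta>\<in>PiE (insert i S) (\<lambda>_. {..<N}).
      tensor_weight N p R (insert i S) z \<beta> * F (interp_node N p R (insert i S) z \<beta>))
      = (\<Sum>j<N. interp_weight N u j * P (update_coord z i (t j)))"
    using insert.hyps(2) by (simp add: sum_PiE_insert P_def sum_distrib_left mult.assoc)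
  have upd: "update_coord z i s \<in> polydisc p R" if "s \<in> cball (p $ i) R" for s
    using that insert.prems(1) by (auto simp: polydisc_def dist_norm norm_minus_commute)
  have "norm (F z - (\<Sum>j<N. interp_weight N u j * F (update_coord z i (t j)))) \<le> 6 * B * (1/2) ^ N"
    using interp_error[OF holo[OF insert.prems(1), of i] \<open>R > 0\<close> bound[OF upd] insert.prems(2)[OF insertI1], of N]
    unfolding u_def t_def update_coord_self .
  moreover have "norm (\<Sum>j<N. interp_weight N u j * (F (update_coord z i (t j)) - P (update_coord z i (t j))))
      \<le> 2 * E"
  proof -
    \<comment> \<open>Coordinate \<open>i\<close> of the updated point is at distance
      \<open>R/2\<close> from the centre, beyond \<open>R/4\<close>. The induction hypothesis still
      applies, since it asks for closeness \<open>R/4\<close> only in \<open>S\<close> and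
      \<open>i \<notin> S\<close>.\<close>
    have *: "norm (F (update_coord z i (t j)) - P (update_coord z i (t j))) \<le> E" for j
      unfolding P_def E_def
    proof (rule insert.IH)
      show "update_coord z i (t j) \<in> polydisc p R"
        using \<open>R > 0\<close> by (intro upd) (simp add: t_def dist_norm norm_mult)
      show "norm (update_coord z i (t j) $ k - p $ k) \<le> R / 4" if "k \<in> S" for k
        using that insert.hyps(2) insert.prems(2)[of k] by auto
    qed
    have "norm (\<Sum>j<N. interp_weight N u j * (F (update_coord z i (t j)) - P (update_coord z i (t j))))
        \<le> (\<Sum>j<N. norm (interp_weight N u j) * E)"
      by (intro sum_norm_le) (auto simp: norm_mult intro!: mult_left_mono *)
    also have "\<dots> \<le> 2 * E"
      unfolding sum_distrib_right[symmetric]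
      using order_trans[OF norm_ge_zero *]
      by (intro mult_right_mono sum_norm_interp_weight_le \<open>norm u \<le> 1/2\<close>) auto
    finally show ?thesis .
  qed
  \<comment> \<open>The error of interpolating in coordinate \<open>i\<close> alone, plus the
    weighted errors of the remaining coordinates at its nodes.\<close>
  moreover have "F z - (\<Sum>j<N. interp_weight N u j * P (update_coord z i (t j)))
    = (F z - (\<Sum>j<N. interp_weight N u j * F (update_coord z i (t j))))
      + (\<Sum>j<N. interp_weight N u j * (F (update_coord z i (t j)) - P (update_coord z i (t j))))"
    by (simp add: algebra_simps sum_subtractf)
  ultimately have "norm (F z - (\<Sum>j<N. interp_weight N u j * P (update_coord z i (t j))))
      \<le> 6 * B * (1/2) ^ N + 2 * E"
    by (simp only: norm_triangle_mono)
  also have "\<dots> = 6 * (2 ^ card (insert i S) - 1) * B * (1/2) ^ N"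
    using insert.hyps by (simp add: E_def algebra_simps)
  finally show ?case
    unfolding split .
qed

lemma norm_tensor_weight_le:
  assumes "\<And>i. i \<in> S \<Longrightarrow> norm (z $ i - p $ i) \<le> R / 4" and "R > 0"
  shows "norm (tensor_weight N p R S z \<beta>) \<le> 2 ^ card S"
proof -
  have "norm (tensor_weight N p R S z \<beta>) \<le> (\<Prod>i\<in>S. 2)"
    unfolding tensor_weight_def prod_norm[symmetric] using assms
    by (intro prod_mono conjI norm_ge_zero norm_interp_weight_le_2 norm_rescale_le_half) auto
  then show ?thesis
    by simp
qed

section \<open>Linf-valued holomorphic maps\<close>

lemma Linf_norm_le_iff:
  assumes "f \<in> borel_measurable (lebesgue_on I)"
  shows "Linf_norm I f \<le> ereal B \<longleftrightarrow> (AE x in lebesgue_on I. norm (f x) \<le> B)"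
proof
  assume "Linf_norm I f \<le> ereal B"
  have "AE x in lebesgue_on I. ereal (norm (f x)) \<le> Linf_norm I f"
    unfolding Linf_norm_def by (rule esssup_AE)
  then show "AE x in lebesgue_on I. norm (f x) \<le> B"
  proof eventually_elim
    case (elim x)
    then have "ereal (norm (f x)) \<le> ereal B"
      using \<open>Linf_norm I f \<le> ereal B\<close> by (rule order_trans)
    then show ?case
      by simp
  qed
next
  assume "AE x in lebesgue_on I. norm (f x) \<le> B"
  then show "Linf_norm I f \<le> ereal B"
    unfolding Linf_norm_def using assms by (intro esssup_I) auto
qed

lemma Linf_space_iff:
  "f \<in> Linf_space I \<longleftrightarrow>
     f \<in> borel_measurable (lebesgue_on I) \<and> (\<exists>B. AE x in lebesgue_on I. norm (f x) \<le> B)"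
proof -
  have "Linf_norm I f < \<infinity> \<longleftrightarrow> (\<exists>B. Linf_norm I f \<le> ereal B)"
    by (cases "Linf_norm I f") auto
  then show ?thesis
    unfolding Linf_space_def mem_Collect_eq using Linf_norm_le_iff by blast
qed

lemma Linf_space_measurable: "f \<in> Linf_space I \<Longrightarrow> f \<in> borel_measurable (lebesgue_on I)"
  by (simp add: Linf_space_def)

lemma Linf_space_integrable:
  fixes f :: "real \<Rightarrow> 'a::{banach, second_countable_topology}"
  assumes "f \<in> Linf_space I" "I \<in> lmeasurable"
  shows "integrable (lebesgue_on I) f"
proof -
  interpret finite_measure "lebesgue_on I"
    using assms by (simp add: finite_measure_lebesgue_on)
  show ?thesis
    using assms(1) by (auto simp: Linf_space_iff intro: integrable_const_bound)
qed

lemma Linf_space_add: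
  assumes "f \<in> Linf_space I" "g \<in> Linf_space I"
  shows "(\<lambda>x. f x + g x :: 'a::{real_normed_vector, second_countable_topology}) \<in> Linf_space I"
proof -
  obtain A B where "AE x in lebesgue_on I. norm (f x) \<le> A" "AE x in lebesgue_on I. norm (g x) \<le> B"
    using assms by (auto simp: Linf_space_iff)
  then have "AE x in lebesgue_on I. norm (f x + g x) \<le> A + B"
    by eventually_elim (rule norm_triangle_mono)
  then show ?thesis
    using assms by (auto simp: Linf_space_iff)
qed

lemma Linf_space_mult_const:
  fixes f :: "real \<Rightarrow> 'a::{real_normed_field, second_countable_topology}"
  assumes "f \<in> Linf_space I"
  shows "(\<lambda>x. c * f x) \<in> Linf_space I"
proof -
  obtain A where "AE x in lebesgue_on I. norm (f x) \<le> A"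
    using assms by (auto simp: Linf_space_iff)
  then have "AE x in lebesgue_on I. norm (c * f x) \<le> norm c * A"
    by eventually_elim (auto simp: norm_mult intro: mult_left_mono)
  then show ?thesis
    using assms by (auto simp: Linf_space_iff)
qed

lemma Linf_space_0 [simp]: "(\<lambda>x. 0) \<in> Linf_space I"
  by (auto simp: Linf_space_iff intro!: exI[of _ 0])

lemma Linf_space_Re:
  assumes "f \<in> Linf_space I"
  shows "(\<lambda>x. Re (f x)) \<in> Linf_space I"
proof -
  obtain A where "AE x in lebesgue_on I. norm (f x) \<le> A"
    using assms by (auto simp: Linf_space_iff)
  then have "AE x in lebesgue_on I. norm (Re (f x)) \<le> A"
    by eventually_elim (use abs_Re_le_cmod order_trans in auto)
  then show ?thesis
    using assms by (auto simp: Linf_space_iff)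
qed

lemma Linf_space_diff:
  fixes f :: "real \<Rightarrow> 'a::{real_normed_field, second_countable_topology}"
  assumes "f \<in> Linf_space I" "g \<in> Linf_space I"
  shows "(\<lambda>x. f x - g x) \<in> Linf_space I"
  using Linf_space_add[OF assms(1) Linf_space_mult_const[OF assms(2), of "-1"]] by simp

lemma Linf_space_sum:
  fixes f :: "'i \<Rightarrow> real \<Rightarrow> 'a::{real_normed_vector, second_countable_topology}"
  assumes "\<And>i. i \<in> J \<Longrightarrow> f i \<in> Linf_space I"
  shows "(\<lambda>x. \<Sum>i\<in>J. f i x) \<in> Linf_space I"
  using assms by (induction J rule: infinite_finite_induct) (auto intro: Linf_space_add)

lemma borel_measurable_lebesgue_on_subset:
  assumes "f \<in> borel_measurable (lebesgue_on I)" "A \<subseteq> I"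
  shows "f \<in> borel_measurable (lebesgue_on A)"
  using assms by (rule measurable_restrict_mono)

lemma AE_lebesgue_on_subset:
  assumes "AE x in lebesgue_on I. P x" "A \<subseteq> I" "A \<in> sets lebesgue" "I \<in> sets lebesgue"
  shows "AE x in lebesgue_on A. P x"
proof -
  have "AE x in lebesgue. x \<in> I \<longrightarrow> P x"
    using assms by (simp add: AE_restrict_space_iff)
  then have "AE x in lebesgue. x \<in> A \<longrightarrow> P x"
    by eventually_elim (use assms(2) in auto)
  then show ?thesis
    using assms by (simp add: AE_restrict_space_iff)
qed

lemma Linf_space_subset:
  assumes "f \<in> Linf_space I" "A \<subseteq> I" "A \<in> sets lebesgue" "I \<in> sets lebesgue"
  shows "f \<in> Linf_space A"
  using assms borel_measurable_lebesgue_on_subset AE_lebesgue_on_subset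
  unfolding Linf_space_iff by metis

section \<open>Integrals over subsets as scalar test functionals\<close>

lemma norm_integral_le_Linf:
  fixes f :: "real \<Rightarrow> 'a::{banach, second_countable_topology}"
  assumes "f \<in> borel_measurable (lebesgue_on I)" "AE x in lebesgue_on I. norm (f x) \<le> B" "I \<in> lmeasurable"
  shows "norm (\<integral>x. f x \<partial>lebesgue_on I) \<le> B * measure lebesgue I"
proof -
  interpret finite_measure "lebesgue_on I"
    using assms by (simp add: finite_measure_lebesgue_on)
  have int: "integrable (lebesgue_on I) f"
    using assms by (auto intro: integrable_const_bound)
  have "norm (\<integral>x. f x \<partial>lebesgue_on I) \<le> (\<integral>x. norm (f x) \<partial>lebesgue_on I)"
    by (rule integral_norm_bound)
  also have "\<dots> \<le> (\<integral>x. B \<partial>lebesgue_on I)"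
    using int assms(2) by (intro integral_mono_AE) auto
  also have "\<dots> = B * measure lebesgue I"
    using assms(3) by (simp add: measure_restrict_space fmeasurableD)
  finally show ?thesis .
qed

text \<open>Test the hypothesis on the set where \<open>h\<close> exceeds \<open>E\<close>. There
  \<open>h - E\<close> is positive while its integral is at most 0, so the set is null.\<close>

lemma AE_le_if_averages_le:
  fixes h :: "real \<Rightarrow> real"
  assumes h: "h \<in> Linf_space I" and "I \<in> lmeasurable"
    and avg: "\<And>A. A \<subseteq> I \<Longrightarrow> A \<in> lmeasurable \<Longrightarrow> (\<integral>x. h x \<partial>lebesgue_on A) \<le> E * measure lebesgue A"
  shows "AE x in lebesgue_on I. h x \<le> E"
proof -
  define A where "A = {x \<in> I. h x > E}"
  have [measurable]: "h \<in> borel_measurable (lebesgue_on I)"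
    using h by (rule Linf_space_measurable)
  have "{x \<in> space (lebesgue_on I). h x > E} \<in> sets (lebesgue_on I)"
    by measurable
  then have "A \<in> sets (lebesgue_on I)"
    by (simp add: A_def)
  then have A: "A \<subseteq> I" "A \<in> sets lebesgue"
    using \<open>I \<in> lmeasurable\<close> sets_restrict_space_iff[of I lebesgue] by (auto simp: fmeasurableD)
  then have "A \<in> lmeasurable"
    using \<open>I \<in> lmeasurable\<close> fmeasurableI2 by blast
  interpret finite_measure "lebesgue_on A"
    using \<open>A \<in> lmeasurable\<close> by (rule finite_measure_lebesgue_on)
  have int: "integrable (lebesgue_on A) h"
    using h A \<open>I \<in> lmeasurable\<close> \<open>A \<in> lmeasurable\<close>
    by (intro Linf_space_integrable Linf_space_subset[OF h]) (auto simp: fmeasurableD)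
  have "(\<integral>x. h x - E \<partial>lebesgue_on A) = (\<integral>x. h x \<partial>lebesgue_on A) - E * measure lebesgue A"
    using int A by (simp add: measure_restrict_space)
  also have "\<dots> \<le> 0"
    using avg[OF A(1) \<open>A \<in> lmeasurable\<close>] by simp
  finally have le: "(\<integral>x. h x - E \<partial>lebesgue_on A) \<le> 0" .
  have nonneg: "AE x in lebesgue_on A. 0 \<le> h x - E"
    by (rule AE_I2) (auto simp: A_def)
  have "(\<integral>x. h x - E \<partial>lebesgue_on A) = 0"
    using le integral_nonneg_AE[OF nonneg] by simp
  then have "AE x in lebesgue_on A. h x - E = 0"
    using integral_nonneg_eq_0_iff_AE[OF _ nonneg] int by simp
  then have "AE x in lebesgue. x \<in> A \<longrightarrow> h x - E = 0"
    using A by (simp add: AE_restrict_space_iff)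
  then have "AE x in lebesgue. x \<in> I \<longrightarrow> h x \<le> E"
    by eventually_elim (auto simp: A_def)
  then show ?thesis
    using \<open>I \<in> lmeasurable\<close> by (simp add: AE_restrict_space_iff fmeasurableD)
qed

lemma AE_abs_le_if_averages_le:
  fixes h :: "real \<Rightarrow> real"
  assumes h: "h \<in> Linf_space I" and I: "I \<in> lmeasurable"
    and avg: "\<And>A. A \<subseteq> I \<Longrightarrow> A \<in> lmeasurable \<Longrightarrow> \<bar>\<integral>x. h x \<partial>lebesgue_on A\<bar> \<le> E * measure lebesgue A"
  shows "AE x in lebesgue_on I. \<bar>h x\<bar> \<le> E"
proof -
  have "AE x in lebesgue_on I. h x \<le> E"
    using avg abs_le_D1 by (intro AE_le_if_averages_le[OF h I]) blast
  moreover have "AE x in lebesgue_on I. - h x \<le> E"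
  proof (rule AE_le_if_averages_le[OF _ I])
    show "(\<lambda>x. - h x) \<in> Linf_space I"
      using Linf_space_mult_const[OF h, of "-1"] by simp
    show "(\<integral>x. - h x \<partial>lebesgue_on A) \<le> E * measure lebesgue A"
      if "A \<subseteq> I" "A \<in> lmeasurable" for A
      using avg[OF that] by simp
  qed
  ultimately show ?thesis
    by eventually_elim auto
qed

text \<open>Integration over a set of finite measure is a bounded linear functional on L-infinity,
  so it carries the L-infinity valued derivative in direction \<open>i\<close> to a complex
  derivative.\<close>

lemma holomorphic_integral:
  assumes G: "Linf_holomorphic_on I G U" and I: "I \<in> lmeasurable"
    and A: "A \<subseteq> I" "A \<in> lmeasurable"
    and U: "polydisc p R \<subseteq> U" and z: "z \<in> polydisc p R"
  shows "(\<lambda>t. \<integral>x. G (update_coord z i t) x \<partial>lebesgue_on A) holomorphic_on cball (p $ i) R"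
proof (rule holomorphic_onI)
  fix t assume t: "t \<in> cball (p $ i) R"
  have upd: "update_coord z i s \<in> U" if "s \<in> cball (p $ i) R" for s
    using that z U by (auto simp: polydisc_def dist_norm norm_minus_commute)
  have sets: "A \<in> sets lebesgue" "I \<in> sets lebesgue"
    using A I by (auto simp: fmeasurableD)
  define w where "w = update_coord z i t"
  obtain L where *: "(\<forall>v. L v \<in> Linf_space I) \<and>
      (\<forall>v w. L (v + w) = (\<lambda>x. L v x + L w x)) \<and>
      (\<forall>a v. L (a *s v) = (\<lambda>x. a * L v x)) \<and>
      (\<forall>\<epsilon>>0. \<exists>\<delta>>0. \<forall>h. norm h < \<delta> \<longrightarrow> w + h \<in> U \<longrightarrow>
          Linf_norm I (\<lambda>x. G (w + h) x - G w x - L h x) \<le> ereal (\<epsilon> * norm h))"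
    using conjunct2[OF bspec[OF G[unfolded Linf_holomorphic_on_def] upd[OF t], folded w_def]]
    by (rule exE)
  then have L: "L v \<in> Linf_space I" and scale: "L (a *s v) = (\<lambda>x. a * L v x)" for a v
    by simp_all
  have GI: "G s \<in> Linf_space I" if "s \<in> U" for s
    using G that by (auto simp: Linf_holomorphic_on_def)
  have int: "integrable (lebesgue_on A) f" if "f \<in> Linf_space I" for f :: "real \<Rightarrow> complex"
    using that A sets by (intro Linf_space_integrable) (auto intro: Linf_space_subset)
  \<comment> \<open>The candidate derivative: the functional applied to the derivative of
    \<open>G\<close> in the \<open>i\<close>-th coordinate direction.\<close>
  define D where "D = (\<integral>x. L (axis i 1) x \<partial>lebesgue_on A)"
  have "((\<lambda>t. \<integral>x. G (update_coord z i t) x \<partial>lebesgue_on A) has_field_derivative D)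
      (at t within cball (p $ i) R)"
    unfolding has_field_derivative_def has_derivative_within_alt
  proof (intro conjI allI impI bounded_linear_mult_right)
    fix e :: real assume "e > 0"
    define m where "m = measure lebesgue A"
    have "m \<ge> 0"
      by (simp add: m_def)
    \<comment> \<open>The \<open>+ 1\<close> avoids a division by zero when \<open>A\<close> is
      null.\<close>
    define \<epsilon> where "\<epsilon> = e / (m + 1)"
    have "\<epsilon> > 0" and \<epsilon>m: "\<epsilon> * m \<le> e"
      using \<open>e > 0\<close> \<open>m \<ge> 0\<close> by (auto simp: \<epsilon>_def field_simps)
    obtain \<delta> where "\<delta> > 0" and \<delta>: "\<And>h. norm h < \<delta> \<Longrightarrow> w + h \<in> U \<Longrightarrow>
              Linf_norm I (\<lambda>x. G (w + h) x - G w x - L h x) \<le> ereal (\<epsilon> * norm h)"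
      using * \<open>\<epsilon> > 0\<close> by meson
    have "norm ((\<integral>x. G (update_coord z i y) x \<partial>lebesgue_on A)
            - (\<integral>x. G (update_coord z i t) x \<partial>lebesgue_on A) - D * (y - t)) \<le> e * norm (y - t)"
      if y: "y \<in> cball (p $ i) R" and near: "norm (y - t) < \<delta>" for y
    proof -
      \<comment> \<open>Written as a complex multiple of a unit vector, so that complex homogeneity
        of \<open>L\<close> pulls out the factor \<open>y - t\<close>.\<close>
      define h where "h = (y - t) *s axis i (1::complex)"
      have wh: "w + h = update_coord z i y"
        by (auto simp: w_def h_def vec_eq_iff axis_def)
      have "h = axis i (y - t)"
        by (auto simp: h_def vec_eq_iff axis_def)
      then have nh: "norm h = norm (y - t)"
        by (simp add: norm_vec_def L2_set_def axis_def if_distrib[of norm] if_distrib[of "\<lambda>x. x\<^sup>2"] cong: if_cong)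
      let ?r = "\<lambda>x. G (w + h) x - G w x - L h x"
      have r: "?r \<in> Linf_space I"
        using upd[OF y] upd[OF t] wh by (intro Linf_space_diff GI L) (auto simp: w_def)
      have "Linf_norm I ?r \<le> ereal (\<epsilon> * norm h)"
        using near upd[OF y] by (intro \<delta>) (auto simp: nh wh)
      then have "AE x in lebesgue_on A. norm (?r x) \<le> \<epsilon> * norm h"
        using r A sets by (subst (asm) Linf_norm_le_iff)
          (auto intro: AE_lebesgue_on_subset dest: Linf_space_measurable)
      then have "norm (\<integral>x. ?r x \<partial>lebesgue_on A) \<le> \<epsilon> * norm h * m"
        unfolding m_def using r A sets
        by (intro norm_integral_le_Linf) (auto intro: Linf_space_subset Linf_space_measurable)
      also have "\<dots> = (\<epsilon> * m) * norm (y - t)"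
        by (simp add: nh)
      also have "\<dots> \<le> e * norm (y - t)"
        by (intro mult_right_mono \<epsilon>m) auto
      finally have le: "norm (\<integral>x. ?r x \<partial>lebesgue_on A) \<le> e * norm (y - t)" .
      have "(\<integral>x. ?r x \<partial>lebesgue_on A) = (\<integral>x. G (w + h) x \<partial>lebesgue_on A)
            - (\<integral>x. G w x \<partial>lebesgue_on A) - (\<integral>x. L h x \<partial>lebesgue_on A)"
        using upd[OF y] upd[OF t] wh
        by (simp add: Bochner_Integration.integral_diff int GI L w_def)
      moreover have "(\<integral>x. L h x \<partial>lebesgue_on A) = D * (y - t)"
        unfolding h_def scale D_def by (simp add: mult.commute)
      ultimately show ?thesis
        using le unfolding wh w_def[symmetric] by simp
    qed
    then show "\<exists>d>0. \<forall>y\<in>cball (p $ i) R. norm (y - t) < d \<longrightarrow>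
        norm ((\<integral>x. G (update_coord z i y) x \<partial>lebesgue_on A)
            - (\<integral>x. G (update_coord z i t) x \<partial>lebesgue_on A) - D * (y - t)) \<le> e * norm (y - t)"
      using \<open>\<delta> > 0\<close> by blast
  qed
  then show "(\<lambda>t. \<integral>x. G (update_coord z i t) x \<partial>lebesgue_on A) field_differentiable
      (at t within cball (p $ i) R)"
    by (auto simp: field_differentiable_def)
qed

text \<open>Once every coordinate is interpolated, the nodes no longer depend on \<open>z\<close>.
  Hence one finite set of values of \<open>G\<close> serves the whole polydisc and only the weights
  vary.\<close>

lemma interp_node_UNIV: "interp_node N p R UNIV z \<beta> = interp_node N p R UNIV p \<beta>"
  by (simp add: interp_node_def)

lemma interp_node_in_polydisc:
  assumes "R > 0" "z \<in> polydisc p R"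
  shows "interp_node N p R S z \<beta> \<in> polydisc p R"
  using assms by (auto simp: interp_node_def polydisc_def norm_mult)

text \<open>For each \<open>A\<close> the integral of \<open>G\<close> over \<open>A\<close> is a
  scalar function, holomorphic in each coordinate and bounded by
  \<open>B * measure lebesgue A\<close>, so the scalar estimate applies. Interpolation is linear and
  commutes with the integral, and an error proportional to the measure of \<open>A\<close> is what
  \<open>AE_abs_le_if_averages_le\<close> converts into a pointwise bound. The real part is taken
  because that criterion is for real functions.\<close>

lemma Linf_interp_error:
  fixes G :: "complex^'m \<Rightarrow> real \<Rightarrow> complex"
  assumes G: "Linf_holomorphic_on I G U" and I: "I \<in> lmeasurable"
    and U: "polydisc p R \<subseteq> U" and "R > 0"
    and bound: "\<And>z. z \<in> polydisc p R \<Longrightarrow> Linf_norm I (G z) \<le> ereal B"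
    and z: "\<And>i. norm (z $ i - p $ i) \<le> R / 4"
  shows "AE x in lebesgue_on I. \<bar>Re (G z x - (\<Sum>\<beta>\<in>PiE UNIV (\<lambda>_. {..<N}).
           tensor_weight N p R UNIV z \<beta> * G (interp_node N p R UNIV p \<beta>) x))\<bar>
           \<le> 6 * (2 ^ CARD('m) - 1) * B * (1/2) ^ N"
    (is "AE x in _. \<bar>Re (?H x)\<bar> \<le> ?E")
proof (rule AE_abs_le_if_averages_le[OF _ I])
  have zp: "z \<in> polydisc p R" and pp: "p \<in> polydisc p R"
    using order_trans[OF z, of R] \<open>R > 0\<close> by (auto simp: polydisc_def)
  have node: "interp_node N p R UNIV p \<beta> \<in> polydisc p R" for \<beta>
    by (rule interp_node_in_polydisc[OF \<open>R > 0\<close> pp])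
  have GI: "G s \<in> Linf_space I" if "s \<in> polydisc p R" for s
    using G U that by (auto simp: Linf_holomorphic_on_def)
  have H: "?H \<in> Linf_space I"
    by (intro Linf_space_diff Linf_space_sum Linf_space_mult_const GI zp node)
  show "(\<lambda>x. Re (?H x)) \<in> Linf_space I"
    using H by (rule Linf_space_Re)
  fix A assume A: "A \<subseteq> I" "A \<in> lmeasurable"
  have sets: "A \<in> sets lebesgue" "I \<in> sets lebesgue"
    using A I by (auto simp: fmeasurableD)
  have int: "integrable (lebesgue_on A) f" if "f \<in> Linf_space I" for f :: "real \<Rightarrow> complex"
    using that A sets by (intro Linf_space_integrable) (auto intro: Linf_space_subset)
  define F where "F z = (\<integral>x. G z x \<partial>lebesgue_on A)" for z
  have "norm (F s) \<le> B * measure lebesgue A" if s: "s \<in> polydisc p R" for s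
  proof -
    have "AE x in lebesgue_on A. norm (G s x) \<le> B"
      using bound[OF s] Linf_norm_le_iff[of "G s" I B] GI[OF s] A sets
      by (auto intro: AE_lebesgue_on_subset dest: Linf_space_measurable)
    then show ?thesis
      unfolding F_def using GI[OF s] A sets
      by (intro norm_integral_le_Linf) (auto intro: Linf_space_subset Linf_space_measurable)
  qed
  then have "norm (F z - (\<Sum>\<beta>\<in>PiE UNIV (\<lambda>_. {..<N}).
      tensor_weight N p R UNIV z \<beta> * F (interp_node N p R UNIV z \<beta>)))
      \<le> 6 * (2 ^ card (UNIV :: 'm set) - 1) * (B * measure lebesgue A) * (1/2) ^ N"
    using z zp \<open>R > 0\<close> unfolding F_def
    by (intro tensor_interp_error holomorphic_integral[OF G I A U]) auto
  also have "F z - (\<Sum>\<beta>\<in>PiE UNIV (\<lambda>_. {..<N}).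
      tensor_weight N p R UNIV z \<beta> * F (interp_node N p R UNIV z \<beta>)) = (\<integral>x. ?H x \<partial>lebesgue_on A)"
    unfolding F_def interp_node_UNIV[of N p R z]
    by (simp add: Bochner_Integration.integral_diff Bochner_Integration.integral_sum int GI zp node
        Linf_space_mult_const Linf_space_sum)
  finally have "norm (\<integral>x. ?H x \<partial>lebesgue_on A) \<le> ?E * measure lebesgue A"
    by (simp add: mult_ac)
  moreover have "(\<integral>x. Re (?H x) \<partial>lebesgue_on A) = Re (\<integral>x. ?H x \<partial>lebesgue_on A)"
    by (rule integral_Re) (rule int[OF H])
  ultimately show "\<bar>\<integral>x. Re (?H x) \<partial>lebesgue_on A\<bar> \<le> ?E * measure lebesgue A"
    using abs_Re_le_cmod[of "\<integral>x. ?H x \<partial>lebesgue_on A"] by linarith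
qed

section \<open>From exponential approximability to widths and entropy numbers\<close>

text \<open>At \<open>N = 0\<close> there are no basis functions (for \<open>m > 0\<close>), so \<open>M\<close> also bounds \<open>F\<close> itself; this is
  why the decay bounds below need no separate treatment of small \<open>n\<close>.\<close>

definition exp_approximable :: "real set \<Rightarrow> nat \<Rightarrow> (real \<Rightarrow> real) set \<Rightarrow> bool" where
  "exp_approximable I m F \<longleftrightarrow> (\<exists>M K :: nat. 0 < K \<and> (\<forall>N. \<exists>b :: nat \<Rightarrow> real \<Rightarrow> real.
     (\<forall>i<K * N ^ m. b i \<in> Linf_space I \<and> (AE x in lebesgue_on I. \<bar>b i x\<bar> \<le> real M)) \<and>
     (\<forall>f\<in>F. \<exists>c. (\<forall>i<K * N ^ m. \<bar>c i\<bar> \<le> real M) \<and>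
        (AE x in lebesgue_on I. \<bar>f x - (\<Sum>i<K * N ^ m. c i * b i x)\<bar> \<le> real M * (1/2) ^ N))))"

text \<open>\<open>N\<close> is the integer part of the real solution \<open>y\<close> of
  \<open>K * y ^ s = n\<close>. Rounding down keeps the budget \<open>n\<close>, and the
  \<open>+ 1\<close> is the price of rounding.\<close>

lemma budget_exponent:
  assumes "0 < K" "0 < s"
  obtains N :: nat where "K * N ^ s \<le> n"
    and "real n powr (1 / real s) \<le> real K powr (1 / real s) * (real N + 1)"
proof
  define y where "y = (real n / real K) powr (1 / real s)"
  define N where "N = nat \<lfloor>y\<rfloor>"
  have "y \<ge> 0"
    by (simp add: y_def)
  then have "real N \<le> y" "y \<le> real N + 1"
    by (simp_all add: N_def)
  have "real N ^ s \<le> y ^ s"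
    using \<open>real N \<le> y\<close> by (intro power_mono) auto
  also have "y ^ s = real n / real K"
    using assms by (cases "n = 0") (auto simp: y_def powr_power)
  finally have "real (K * N ^ s) \<le> real n"
    using assms by (simp add: field_simps)
  then show "K * N ^ s \<le> n"
    by (simp only: of_nat_le_iff)
  have "real n powr (1 / real s) = real K powr (1 / real s) * y"
    using assms by (simp add: y_def powr_divide)
  also have "\<dots> \<le> real K powr (1 / real s) * (real N + 1)"
    using \<open>y \<le> real N + 1\<close> by (intro mult_left_mono) auto
  finally show "real n powr (1 / real s) \<le> real K powr (1 / real s) * (real N + 1)" .
qed

text \<open>Converts decay in \<open>N\<close> into decay in a power of \<open>n\<close>; the
  \<open>+ 1\<close> from rounding becomes the constant factor \<open>exp a\<close>.\<close>

lemma exp_decay_in_budget: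
  fixes a :: real
  assumes "real n powr r \<le> k * (real N + 1)" "k > 0" "a > 0"
  shows "exp (- a * real N) \<le> exp a * exp (- (a / k) * real n powr r)"
proof -
  have "real n powr r / k \<le> real N + 1"
    using assms by (simp add: field_simps)
  then have "a * (real n powr r / k) \<le> a * (real N + 1)"
    using assms by (intro mult_left_mono) auto
  then show ?thesis
    by (simp add: exp_add[symmetric] algebra_simps)
qed

lemma half_power_eq_exp: "(1/2) ^ N = exp (- ln 2 * real N)"
  by (simp add: exp_minus exp_of_nat2_mult power_one_over inverse_eq_divide)

lemma kolmogorov_width_exp_decay:
  assumes F: "exp_approximable I m F" "F \<subseteq> Linf_space I" and m: "m > 0"
  shows "\<exists>a>0. \<exists>C>0. \<forall>n. kolmogorov_width I n F \<le> ereal (C * exp (- a * real n powr (1 / real m)))"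
proof -
  obtain M K :: nat where K: "K > 0" and approx: "\<And>N. \<exists>b :: nat \<Rightarrow> real \<Rightarrow> real.
     (\<forall>i<K * N ^ m. b i \<in> Linf_space I \<and> (AE x in lebesgue_on I. \<bar>b i x\<bar> \<le> real M)) \<and>
     (\<forall>f\<in>F. \<exists>c. (\<forall>i<K * N ^ m. \<bar>c i\<bar> \<le> real M) \<and>
        (AE x in lebesgue_on I. \<bar>f x - (\<Sum>i<K * N ^ m. c i * b i x)\<bar> \<le> real M * (1/2) ^ N))"
    using F(1) unfolding exp_approximable_def by blast
  define k where "k = real K powr (1 / real m)"
  have "k > 0"
    using K by (simp add: k_def)
  \<comment> \<open>The factor 2 is \<open>exp (ln 2)\<close>, the rounding loss at rate
    \<open>ln 2\<close>; the \<open>+ 1\<close> keeps the constant positive when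
    \<open>M = 0\<close>.\<close>
  have "kolmogorov_width I n F \<le> ereal ((2 * real M + 1) * exp (- (ln 2 / k) * real n powr (1 / real m)))" for n
  proof -
    obtain N where N: "K * N ^ m \<le> n" "real n powr (1 / real m) \<le> k * (real N + 1)"
      using budget_exponent[OF K m] unfolding k_def by metis
    define D where "D = K * N ^ m"
    obtain b where b: "\<And>i. i < D \<Longrightarrow> b i \<in> Linf_space I"
      and c: "\<And>f. f \<in> F \<Longrightarrow> \<exists>c. AE x in lebesgue_on I. \<bar>f x - (\<Sum>i<D. c i * b i x)\<bar> \<le> real M * (1/2) ^ N"
      using approx[of N] unfolding D_def by blast
    \<comment> \<open>The width ranges over families of \<open>n\<close> functions, so the
      \<open>D \<le> n\<close> available ones are padded with zeros.\<close>
    define b' where "b' i = (if i < D then b i else (\<lambda>x. 0))" for i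
    have b': "b' i \<in> Linf_space I" for i
      by (simp add: b'_def b)
    have "kolmogorov_width I n F \<le> ereal (real M * (1/2) ^ N)"
      unfolding kolmogorov_width_def
    proof (intro INF_lower2[of b'] SUP_least)
      fix f assume "f \<in> F"
      then obtain c where c: "AE x in lebesgue_on I. \<bar>f x - (\<Sum>i<D. c i * b i x)\<bar> \<le> real M * (1/2) ^ N"
        using c by blast
      have "(\<Sum>i<n. c i * b' i x) = (\<Sum>i<D. c i * b i x)" for x
        using N(1) by (intro sum.mono_neutral_cong_right) (auto simp: b'_def D_def)
      moreover have "(\<lambda>x. f x - (\<Sum>i<n. c i * b' i x)) \<in> Linf_space I"
        using \<open>f \<in> F\<close> F(2) by (intro Linf_space_diff Linf_space_sum Linf_space_mult_const b') auto
      ultimately have "Linf_norm I (\<lambda>x. f x - (\<Sum>i<n. c i * b' i x)) \<le> ereal (real M * (1/2) ^ N)"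
        using c by (subst Linf_norm_le_iff) (auto dest: Linf_space_measurable)
      then show "(INF c. Linf_norm I (\<lambda>x. f x - (\<Sum>i<n. c i * b' i x))) \<le> ereal (real M * (1/2) ^ N)"
        by (intro INF_lower2[of c]) auto
    qed (simp add: b')
    also have "real M * (1/2) ^ N \<le> (2 * real M + 1) * exp (- (ln 2 / k) * real n powr (1 / real m))"
    proof -
      have "(1/2) ^ N \<le> 2 * exp (- (ln 2 / k) * real n powr (1 / real m))"
        using exp_decay_in_budget[OF N(2) \<open>k > 0\<close>, of "ln 2"] by (simp add: half_power_eq_exp)
      then have "real M * (1/2) ^ N \<le> real M * (2 * exp (- (ln 2 / k) * real n powr (1 / real m)))"
        by (intro mult_left_mono) auto
      also have "\<dots> \<le> (2 * real M + 1) * exp (- (ln 2 / k) * real n powr (1 / real m))"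
        by (simp add: algebra_simps)
      finally show ?thesis .
    qed
    finally show ?thesis
      by simp
  qed
  then show ?thesis
    using \<open>k > 0\<close> by (intro exI[of _ "ln 2 / k"] conjI exI[of _ "2 * real M + 1"] allI) auto
qed

text \<open>The coefficients of the approximants are averaged with the weights of the combination.\<close>

lemma l1_combinations_approx:
  fixes b :: "nat \<Rightarrow> real \<Rightarrow> real"
  assumes h: "h \<in> l1_combinations F" and "M \<ge> 0" "\<delta> \<ge> 0"
    and approx: "\<And>f. f \<in> F \<Longrightarrow> \<exists>c. (\<forall>i<D. \<bar>c i\<bar> \<le> M) \<and>
        (AE x in lebesgue_on I. \<bar>f x - (\<Sum>i<D. c i * b i x)\<bar> \<le> \<delta>)"
  obtains d where "\<And>i. i < D \<Longrightarrow> \<bar>d i\<bar> \<le> M"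
    and "AE x in lebesgue_on I. \<bar>h x - (\<Sum>i<D. d i * b i x)\<bar> \<le> \<delta>"
proof -
  obtain k a g where g: "\<And>j. j < k \<Longrightarrow> g j \<in> F" and a: "(\<Sum>j<k. \<bar>a j\<bar>) \<le> 1"
    and h_eq: "h = (\<lambda>x. \<Sum>j<(k::nat). a j * g j x)"
    using h unfolding l1_combinations_def by blast
  have "\<forall>j\<in>{..<k}. \<exists>c. (\<forall>i<D. \<bar>c i\<bar> \<le> M) \<and>
        (AE x in lebesgue_on I. \<bar>g j x - (\<Sum>i<D. c i * b i x)\<bar> \<le> \<delta>)"
    using approx g by auto
  then obtain c where c: "\<And>j. j < k \<Longrightarrow> \<forall>i<D. \<bar>c j i\<bar> \<le> M"
    and AE: "\<And>j. j < k \<Longrightarrow> AE x in lebesgue_on I. \<bar>g j x - (\<Sum>i<D. c j i * b i x)\<bar> \<le> \<delta>"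
    unfolding bchoice_iff by auto
  \<comment> \<open>Combinations with l1 weight at most 1 preserve a common bound. This is applied
    twice: to the pointwise errors and to the coefficients.\<close>
  have weighted: "\<bar>\<Sum>j<k. a j * v j\<bar> \<le> B" if "\<And>j. j < k \<Longrightarrow> \<bar>v j\<bar> \<le> B" "B \<ge> 0" for v B
  proof -
    have "\<bar>\<Sum>j<k. a j * v j\<bar> \<le> (\<Sum>j<k. \<bar>a j\<bar> * B)"
      by (rule order_trans[OF sum_abs]) (auto simp: abs_mult intro!: sum_mono mult_left_mono that(1))
    also have "\<dots> \<le> 1 * B"
      unfolding sum_distrib_right[symmetric] using a that(2) by (rule mult_right_mono)
    finally show ?thesis
      by simp
  qed
  define d where "d i = (\<Sum>j<k. a j * c j i)" for i
  have "AE x in lebesgue_on I. \<forall>j\<in>{..<k}. \<bar>g j x - (\<Sum>i<D. c j i * b i x)\<bar> \<le> \<delta>"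
    by (intro AE_finite_allI) (auto intro: AE)
  then have "AE x in lebesgue_on I. \<bar>h x - (\<Sum>i<D. d i * b i x)\<bar> \<le> \<delta>"
  proof eventually_elim
    case (elim x)
    have "(\<Sum>i<D. d i * b i x) = (\<Sum>j<k. a j * (\<Sum>i<D. c j i * b i x))"
      unfolding d_def sum_distrib_left sum_distrib_right by (subst sum.swap) (simp add: mult_ac)
    then have "h x - (\<Sum>i<D. d i * b i x) = (\<Sum>j<k. a j * (g j x - (\<Sum>i<D. c j i * b i x)))"
      by (simp add: h_eq right_diff_distrib sum_subtractf)
    then show ?case
      using weighted[of "\<lambda>j. g j x - (\<Sum>i<D. c j i * b i x)" \<delta>] elim \<open>\<delta> \<ge> 0\<close> by simp
  qed
  moreover have "\<bar>d i\<bar> \<le> M" if "i < D" for i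
    unfolding d_def using c that \<open>M \<ge> 0\<close> by (intro weighted) auto
  ultimately show ?thesis
    using that by blast
qed

section \<open>Rounding coefficients and counting centres\<close>

lemma quantise:
  fixes d :: real and M N :: nat
  assumes "\<bar>d\<bar> \<le> real M"
  shows "\<lfloor>d * 2 ^ N\<rfloor> \<in> {- int M * 2 ^ N .. int M * 2 ^ N}"
    and "\<bar>d - real_of_int \<lfloor>d * 2 ^ N\<rfloor> / 2 ^ N\<bar> \<le> (1/2) ^ N"
proof -
  have "d * 2 ^ N \<le> real M * 2 ^ N"
    by (rule mult_right_mono) (use assms in auto)
  moreover have "- real M * 2 ^ N \<le> d * 2 ^ N"
    by (rule mult_right_mono) (use assms in auto)
  \<comment> \<open>Both bounds are written as casts of integers, so that monotonicity of the floor
    gives exact integer bounds.\<close>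
  ultimately have "d * 2 ^ N \<le> real_of_int (int M * 2 ^ N)" "real_of_int (- int M * 2 ^ N) \<le> d * 2 ^ N"
    by simp_all
  then have "\<lfloor>d * 2 ^ N\<rfloor> \<le> \<lfloor>real_of_int (int M * 2 ^ N)\<rfloor>"
    and "\<lfloor>real_of_int (- int M * 2 ^ N)\<rfloor> \<le> \<lfloor>d * 2 ^ N\<rfloor>"
    by - (rule floor_mono, assumption)+
  then show "\<lfloor>d * 2 ^ N\<rfloor> \<in> {- int M * 2 ^ N .. int M * 2 ^ N}"
    unfolding floor_of_int by (simp only: atLeastAtMost_iff)
  have "\<bar>d * 2 ^ N - real_of_int \<lfloor>d * 2 ^ N\<rfloor>\<bar> \<le> 1"
    by linarith
  then have "\<bar>d * 2 ^ N - real_of_int \<lfloor>d * 2 ^ N\<rfloor>\<bar> / 2 ^ N \<le> 1 / 2 ^ N"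
    by (intro divide_right_mono) auto
  also have "\<bar>d * 2 ^ N - real_of_int \<lfloor>d * 2 ^ N\<rfloor>\<bar> / 2 ^ N = \<bar>(d * 2 ^ N - real_of_int \<lfloor>d * 2 ^ N\<rfloor>) / 2 ^ N\<bar>"
    by simp
  also have "(d * 2 ^ N - real_of_int \<lfloor>d * 2 ^ N\<rfloor>) / 2 ^ N = d - real_of_int \<lfloor>d * 2 ^ N\<rfloor> / 2 ^ N"
    by (simp add: diff_divide_distrib)
  finally show "\<bar>d - real_of_int \<lfloor>d * 2 ^ N\<rfloor> / 2 ^ N\<bar> \<le> (1/2) ^ N"
    by (simp add: power_one_over)
qed

text \<open>Allows centres indexed by any nonempty finite set with at most \<open>2 ^ n\<close>
  elements, in place of the initial segment of naturals in the definition.\<close>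

lemma entropy_number_leI:
  assumes "\<epsilon> > 0" "finite Q" "Q \<noteq> {}" "card Q \<le> 2 ^ n" "\<And>q. q \<in> Q \<Longrightarrow> c q \<in> Linf_space I"
    and cover: "\<And>f. f \<in> F \<Longrightarrow> \<exists>q\<in>Q. Linf_norm I (\<lambda>x. f x - c q x) \<le> ereal \<epsilon>"
  shows "entropy_number I n F \<le> ereal \<epsilon>"
proof -
  obtain h where h: "bij_betw h {0..<card Q} Q"
    using ex_bij_betw_nat_finite[OF \<open>finite Q\<close>] by blast
  obtain q0 where "q0 \<in> Q"
    using \<open>Q \<noteq> {}\<close> by blast
  \<comment> \<open>Indices from \<open>card Q\<close> up to \<open>2 ^ n\<close> repeat the centre
    of \<open>q0\<close>, so that every listed centre is in \<open>Linf_space\<close>.\<close>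
  define e where "e i = (if i < card Q then h i else q0)" for i
  have e: "e i \<in> Q" for i
    using h \<open>q0 \<in> Q\<close> by (auto simp: e_def bij_betw_def)
  have "\<exists>i<2^n. Linf_norm I (\<lambda>x. f x - c (e i) x) \<le> ereal \<epsilon>" if f: "f \<in> F" for f
  proof -
    obtain q where q: "q \<in> Q" "Linf_norm I (\<lambda>x. f x - c q x) \<le> ereal \<epsilon>"
      using cover[OF f] by blast
    have "q \<in> h ` {0..<card Q}"
      using bij_betw_imp_surj_on[OF h] q(1) by simp
    then obtain i where "i \<in> {0..<card Q}" "h i = q"
      by (elim imageE) simp
    then show ?thesis
      using q(2) \<open>card Q \<le> 2 ^ n\<close> by (intro exI[of _ i]) (auto simp: e_def)
  qed
  then have "\<epsilon> \<in> {\<epsilon>. \<epsilon> > 0 \<and> (\<exists>c :: nat \<Rightarrow> real \<Rightarrow> real. (\<forall>i<2^n. c i \<in> Linf_space I) \<and>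
      (\<forall>f\<in>F. \<exists>i<2^n. Linf_norm I (\<lambda>x. f x - c i x) \<le> ereal \<epsilon>))}"
    using \<open>\<epsilon> > 0\<close> assms(5)[OF e] by (intro CollectI conjI exI[of _ "\<lambda>i. c (e i)"]) auto
  then show ?thesis
    unfolding entropy_number_def by (intro Inf_lower imageI)
qed

text \<open>Three errors add up, in units of \<open>(1/2) ^ N\<close>: 1 for passing from the
  closure to a finite combination, \<open>M\<close> for approximating that combination, and
  \<open>D * M\<close> for rounding its \<open>D\<close> coefficients. Each coefficient takes at
  most \<open>2 ^ (N + p)\<close> values, so \<open>(N + p) * D\<close> bits suffice.\<close>

lemma entropy_number_B1_le:
  fixes b :: "nat \<Rightarrow> real \<Rightarrow> real" and M N p D n :: nat
  assumes b: "\<And>i. i < D \<Longrightarrow> b i \<in> Linf_space I"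
    and b_le: "\<And>i. i < D \<Longrightarrow> AE x in lebesgue_on I. \<bar>b i x\<bar> \<le> real M"
    and F: "F \<subseteq> Linf_space I"
    and approx: "\<And>f. f \<in> F \<Longrightarrow> \<exists>c. (\<forall>i<D. \<bar>c i\<bar> \<le> real M) \<and>
        (AE x in lebesgue_on I. \<bar>f x - (\<Sum>i<D. c i * b i x)\<bar> \<le> real M * (1/2) ^ N)"
    and p: "2 * M + 1 \<le> 2 ^ p" and n: "(N + p) * D \<le> n"
  shows "entropy_number I n (B1 I F) \<le> ereal ((1 + real M + real D * real M) * (1/2) ^ N)"
proof -
  define Q where "Q = PiE {..<D} (\<lambda>_. {- int M * 2 ^ N .. int M * 2 ^ N})"
  define c where "c q x = (\<Sum>i<D. real_of_int (q i) / 2 ^ N * b i x)" for q :: "nat \<Rightarrow> int" and x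
  have c: "c q \<in> Linf_space I" for q
    unfolding c_def by (intro Linf_space_sum Linf_space_mult_const b) auto
  show ?thesis
  proof (rule entropy_number_leI[of _ Q _ c])
    show "(1 + real M + real D * real M) * (1/2) ^ N > 0"
      by (intro mult_pos_pos add_pos_nonneg) auto
    show "finite Q" "Q \<noteq> {}"
      by (auto simp: Q_def PiE_eq_empty_iff intro!: finite_PiE)
    have "card Q = (2 * M * 2 ^ N + 1) ^ D"
      by (simp add: Q_def card_PiE nat_add_distrib nat_mult_distrib nat_power_eq mult_ac)
    also have "\<dots> \<le> (2 ^ (N + p)) ^ D"
    proof (rule power_mono)
      have "2 * M * 2 ^ N + 1 \<le> (2 * M + 1) * 2 ^ N"
        by simp
      also have "\<dots> \<le> 2 ^ p * 2 ^ N"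
        using p by (rule mult_right_mono) simp
      finally show "2 * M * 2 ^ N + 1 \<le> 2 ^ (N + p)"
        by (simp add: power_add mult.commute)
    qed simp
    also have "\<dots> \<le> 2 ^ n"
      unfolding power_mult[symmetric] using n by (intro power_increasing) auto
    finally show "card Q \<le> 2 ^ n" .
    show "c q \<in> Linf_space I" for q
      by (rule c)
    fix f assume f: "f \<in> B1 I F"
    then have "f \<in> Linf_space I" by (simp add: B1_def)
    have "(1/2::real) ^ N > 0" by simp
    then obtain h where h: "h \<in> l1_combinations F" and fh: "Linf_norm I (\<lambda>x. f x - h x) < ereal ((1/2) ^ N)"
      using f unfolding B1_def by blast
    have "h \<in> Linf_space I"
      using h F by (auto simp: l1_combinations_def intro!: Linf_space_sum Linf_space_mult_const)
    then have "(\<lambda>x. f x - h x) \<in> borel_measurable (lebesgue_on I)"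
      using \<open>f \<in> Linf_space I\<close> by (intro Linf_space_measurable Linf_space_diff)
    from Linf_norm_le_iff[OF this] less_imp_le[OF fh]
    have fh: "AE x in lebesgue_on I. \<bar>f x - h x\<bar> \<le> (1/2) ^ N"
      by simp
    obtain d where d: "\<And>i. i < D \<Longrightarrow> \<bar>d i\<bar> \<le> real M"
      and hd: "AE x in lebesgue_on I. \<bar>h x - (\<Sum>i<D. d i * b i x)\<bar> \<le> real M * (1/2) ^ N"
      by (rule l1_combinations_approx[OF h _ _ approx]) auto
    \<comment> \<open>Restricted to \<open>{..<D}\<close>, because members of the \<open>PiE\<close>
      set \<open>Q\<close> are \<open>undefined\<close> elsewhere.\<close>
    define q where "q = (\<lambda>i\<in>{..<D}. \<lfloor>d i * 2 ^ N\<rfloor>)"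
    have "q \<in> Q"
      unfolding q_def Q_def by (intro restrict_PiE_iff[THEN iffD2] ballI quantise d) auto
    have "AE x in lebesgue_on I. \<forall>i\<in>{..<D}. \<bar>b i x\<bar> \<le> real M"
      by (intro AE_finite_allI) (auto intro: b_le)
    then have "AE x in lebesgue_on I. \<bar>f x - c q x\<bar> \<le> (1 + real M + real D * real M) * (1/2) ^ N"
      using fh hd
    proof eventually_elim
      case (elim x)
      have "(\<Sum>i<D. d i * b i x) - c q x = (\<Sum>i<D. (d i - real_of_int \<lfloor>d i * 2 ^ N\<rfloor> / 2 ^ N) * b i x)"
        unfolding c_def q_def by (simp add: left_diff_distrib sum_subtractf)
      also have "\<bar>\<dots>\<bar> \<le> (\<Sum>i<D. (1/2) ^ N * real M)"
        using elim(1) by (intro order_trans[OF sum_abs] sum_mono)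
          (auto simp: abs_mult intro!: mult_mono quantise d)
      finally have "\<bar>(\<Sum>i<D. d i * b i x) - c q x\<bar> \<le> real D * real M * (1/2) ^ N"
        by (simp add: mult_ac)
      then have "\<bar>f x - c q x\<bar> \<le> (1/2) ^ N + real M * (1/2) ^ N + real D * real M * (1/2) ^ N"
        using elim(2,3) by linarith
      then show ?case
        by (simp add: algebra_simps)
    qed
    then have "Linf_norm I (\<lambda>x. f x - c q x) \<le> ereal ((1 + real M + real D * real M) * (1/2) ^ N)"
      using \<open>f \<in> Linf_space I\<close> c
      by (subst Linf_norm_le_iff) (auto intro!: Linf_space_measurable Linf_space_diff)
    then show "\<exists>q\<in>Q. Linf_norm I (\<lambda>x. f x - c q x) \<le> ereal ((1 + real M + real D * real M) * (1/2) ^ N)"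
      using \<open>q \<in> Q\<close> by blast
  qed
qed

text \<open>The \<open>m\<close>-th power of \<open>t \<le> exp t\<close> at
  \<open>t = a * N / m\<close>.\<close>

lemma power_le_exp:
  fixes a :: real
  assumes "a > 0" "m > 0"
  shows "real N ^ m \<le> (real m / a) ^ m * exp (a * real N)"
proof -
  have "a * real N / real m \<le> exp (a * real N / real m)"
    using exp_ge_add_one_self[of "a * real N / real m"] by linarith
  then have "(a * real N / real m) ^ m \<le> exp (a * real N / real m) ^ m"
    using assms by (intro power_mono) auto
  also have "\<dots> = exp (a * real N)"
    using assms by (simp add: exp_of_nat_mult[symmetric])
  finally have "(real m / a) ^ m * (a * real N / real m) ^ m \<le> (real m / a) ^ m * exp (a * real N)"
    using assms by (intro mult_left_mono) auto
  then show ?thesis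
    using assms by (simp add: power_mult_distrib[symmetric])
qed

text \<open>Of order \<open>N ^ m\<close> coefficients with of order \<open>N\<close> bits each cost
  \<open>N ^ (m + 1)\<close> bits, which explains the exponent \<open>1 / (m + 1)\<close>. The
  polynomial factor \<open>D\<close> in the error is absorbed by giving up part of the exponential
  rate.\<close>

lemma entropy_number_exp_decay:
  assumes F: "exp_approximable I m F" "F \<subseteq> Linf_space I" and m: "m > 0"
  shows "\<exists>a>0. \<exists>C>0. \<forall>n. entropy_number I n (B1 I F)
           \<le> ereal (C * exp (- a * real n powr (1 / (real m + 1))))"
proof -
  obtain M K :: nat where K: "K > 0" and approx: "\<And>N. \<exists>b :: nat \<Rightarrow> real \<Rightarrow> real.
     (\<forall>i<K * N ^ m. b i \<in> Linf_space I \<and> (AE x in lebesgue_on I. \<bar>b i x\<bar> \<le> real M)) \<and>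
     (\<forall>f\<in>F. \<exists>c. (\<forall>i<K * N ^ m. \<bar>c i\<bar> \<le> real M) \<and>
        (AE x in lebesgue_on I. \<bar>f x - (\<Sum>i<K * N ^ m. c i * b i x)\<bar> \<le> real M * (1/2) ^ N))"
    using F(1) unfolding exp_approximable_def by blast
  \<comment> \<open>Chosen through \<open>x < 2 ^ x\<close>, so that \<open>p\<close> extra bits
    cover the range of the integer parts.\<close>
  define p where "p = 2 * M + 1"
  have p: "2 * M + 1 \<le> 2 ^ p"
    unfolding p_def by (intro less_imp_le less_exp)
  define k where "k = real ((1 + p) * K) powr (1 / real (Suc m))"
  have "k > 0"
    unfolding k_def powr_gt_zero of_nat_eq_0_iff using K by simp
  \<comment> \<open>Half of the rate \<open>ln 2\<close>: the other half absorbs the factor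
    \<open>N ^ m\<close>.\<close>
  define \<alpha> :: real where "\<alpha> = ln 2 / 2"
  have "\<alpha> > 0"
    by (simp add: \<alpha>_def)
  define A where "A = 1 + real M + real K * real M * (real m / \<alpha>) ^ m"
  have "A > 0"
    using \<open>\<alpha> > 0\<close> by (auto simp: A_def intro!: add_pos_nonneg)
  have "entropy_number I n (B1 I F) \<le> ereal (A * exp \<alpha> * exp (- (\<alpha> / k) * real n powr (1 / (real m + 1))))" for n
  proof -
    obtain N where N: "(1 + p) * K * N ^ Suc m \<le> n" "real n powr (1 / real (Suc m)) \<le> k * (real N + 1)"
      using budget_exponent[of "(1 + p) * K" "Suc m" n] K unfolding k_def by auto
    define D where "D = K * N ^ m"
    \<comment> \<open>The comparison of \<open>N + p\<close> with \<open>(1 + p) * N\<close>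
      requires \<open>N > 0\<close>; at \<open>N = 0\<close> the count \<open>D\<close> vanishes
      because \<open>m > 0\<close>.\<close>
    have "(N + p) * D \<le> n"
    proof (cases "N = 0")
      case False
      then have "N + p \<le> (1 + p) * N"
        by (cases N) auto
      then have "(N + p) * D \<le> (1 + p) * N * D"
        by (rule mult_right_mono) simp
      also have "\<dots> = (1 + p) * K * N ^ Suc m"
        by (simp add: D_def algebra_simps)
      finally show ?thesis
        using N(1) by linarith
    qed (use m in \<open>simp add: D_def power_0_left\<close>)
    obtain b where b: "\<And>i. i < D \<Longrightarrow> b i \<in> Linf_space I"
        "\<And>i. i < D \<Longrightarrow> AE x in lebesgue_on I. \<bar>b i x\<bar> \<le> real M"
      and c: "\<And>f. f \<in> F \<Longrightarrow> \<exists>c. (\<forall>i<D. \<bar>c i\<bar> \<le> real M) \<and>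
        (AE x in lebesgue_on I. \<bar>f x - (\<Sum>i<D. c i * b i x)\<bar> \<le> real M * (1/2) ^ N)"
      using approx[of N] unfolding D_def by blast
    have "entropy_number I n (B1 I F) \<le> ereal ((1 + real M + real D * real M) * (1/2) ^ N)"
      by (rule entropy_number_B1_le[OF b F(2) c p \<open>(N + p) * D \<le> n\<close>])
    also have "(1 + real M + real D * real M) * (1/2) ^ N \<le> A * exp (- \<alpha> * real N)"
    proof -
      define E where "E = exp (\<alpha> * real N)"
      have "E \<ge> 1"
        using \<open>\<alpha> > 0\<close> by (simp add: E_def)
      have "real D * real M = real K * real M * real N ^ m"
        by (simp add: D_def)
      also have "\<dots> \<le> real K * real M * ((real m / \<alpha>) ^ m * E)"
        unfolding E_def by (intro mult_left_mono power_le_exp \<open>\<alpha> > 0\<close> m) auto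
      finally have "1 + real M + real D * real M \<le> (1 + real M) * 1 + real K * real M * (real m / \<alpha>) ^ m * E"
        by simp
      also have "\<dots> \<le> (1 + real M) * E + real K * real M * (real m / \<alpha>) ^ m * E"
        using \<open>E \<ge> 1\<close> by (intro add_right_mono mult_left_mono) auto
      also have "\<dots> = A * E"
        by (simp add: A_def algebra_simps)
      finally have "(1 + real M + real D * real M) * (1/2) ^ N \<le> A * E * (1/2) ^ N"
        by (rule mult_right_mono) simp
      also have "E * (1/2) ^ N = exp (- \<alpha> * real N)"
        unfolding half_power_eq_exp E_def exp_add[symmetric] by (simp add: \<alpha>_def field_simps)
      then have "A * E * (1/2) ^ N = A * exp (- \<alpha> * real N)"
        by (simp add: mult.assoc)
      finally show ?thesis .
    qed
    also have "A * exp (- \<alpha> * real N) \<le> A * (exp \<alpha> * exp (- (\<alpha> / k) * real n powr (1 / real (Suc m))))"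
      using \<open>A > 0\<close> exp_decay_in_budget[OF N(2) \<open>k > 0\<close> \<open>\<alpha> > 0\<close>] by (intro mult_left_mono) auto
    also have "\<dots> = A * exp \<alpha> * exp (- (\<alpha> / k) * real n powr (1 / (real m + 1)))"
      by (simp add: add.commute)
    finally show ?thesis
      by simp
  qed
  then show ?thesis
    using \<open>k > 0\<close> \<open>\<alpha> > 0\<close> \<open>A > 0\<close>
    by (intro exI[of _ "\<alpha> / k"] conjI exI[of _ "A * exp \<alpha>"] allI) auto
qed

section \<open>Covering the parameter domain\<close>

lemma norm_le_sum_nth: "norm (z :: 'a::real_normed_vector ^ 'm) \<le> (\<Sum>i\<in>UNIV. norm (z $ i))"
  by (simp add: norm_vec_def L2_set_le_sum)

lemma polydisc_subset_cball: "polydisc p R \<subseteq> cball (p :: complex^'m) (real CARD('m) * R)"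
proof
  fix z assume z: "z \<in> polydisc p R"
  have "norm (z - p) \<le> (\<Sum>i\<in>UNIV. norm ((z - p) $ i))"
    by (rule norm_le_sum_nth)
  also have "\<dots> \<le> real CARD('m) * R"
    using z by (intro sum_bounded_above) (auto simp: polydisc_def)
  finally show "z \<in> cball p (real CARD('m) * R)"
    by (simp add: dist_norm norm_minus_commute)
qed

lemma compact_polydisc: "compact (polydisc p R :: (complex^'m) set)"
proof -
  have "closed (polydisc p R)"
    unfolding polydisc_def by (intro closed_Collect_all closed_Collect_le continuous_intros)
  moreover have "bounded (polydisc p R)"
    using bounded_cball polydisc_subset_cball by (rule bounded_subset)
  ultimately show ?thesis
    by (simp add: compact_eq_bounded_closed)
qed

lemma open_contains_polydisc:
  assumes "open U" "p \<in> U"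
  obtains R where "R > 0" "polydisc (p :: complex^'m) R \<subseteq> U"
proof -
  obtain e where "e > 0" and e: "cball p e \<subseteq> U"
    using assms open_contains_cball by blast
  have "polydisc p (e / real CARD('m)) \<subseteq> cball p (real CARD('m) * (e / real CARD('m)))"
    by (rule polydisc_subset_cball)
  also have "\<dots> = cball p e"
    by simp
  finally show ?thesis
    using e \<open>e > 0\<close> by (intro that[of "e / real CARD('m)"]) auto
qed

text \<open>Turns complex interpolation into real approximation. Each node gives two real functions,
  the real and imaginary parts of \<open>G\<close> there, indexed by the boolean
  (\<open>True\<close> for the real part). These functions are fixed; only the coefficients depend
  on \<open>z\<close>.\<close>

lemma local_approximation:
  fixes G :: "complex^'m \<Rightarrow> real \<Rightarrow> complex"
  assumes G: "Linf_holomorphic_on I G U" and I: "I \<in> lmeasurable"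
    and U: "polydisc p R \<subseteq> U" and "R > 0"
    and bound: "\<And>z. z \<in> polydisc p R \<Longrightarrow> Linf_norm I (G z) \<le> ereal B"
  obtains b :: "('m \<Rightarrow> nat) \<times> bool \<Rightarrow> real \<Rightarrow> real"
  where "\<And>j. b j \<in> Linf_space I" and "\<And>j. AE x in lebesgue_on I. \<bar>b j x\<bar> \<le> B"
    and "\<And>z. (\<And>i. norm (z $ i - p $ i) \<le> R / 4) \<Longrightarrow> \<exists>c. (\<forall>j. \<bar>c j\<bar> \<le> 2 ^ CARD('m)) \<and>
      (AE x in lebesgue_on I. \<bar>Re (G z x) - (\<Sum>j\<in>PiE UNIV (\<lambda>_. {..<N}) \<times> UNIV. c j * b j x)\<bar>
        \<le> 6 * (2 ^ CARD('m) - 1) * B * (1/2) ^ N)"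
proof
  define node where "node \<beta> = interp_node N p R UNIV p \<beta>" for \<beta>
  define b where "b j x = (if snd j then Re (G (node (fst j)) x) else Im (G (node (fst j)) x))"
    for j :: "('m \<Rightarrow> nat) \<times> bool" and x
  have "p \<in> polydisc p R"
    using \<open>R > 0\<close> by (simp add: polydisc_def)
  then have node: "node \<beta> \<in> polydisc p R" for \<beta>
    unfolding node_def by (intro interp_node_in_polydisc \<open>R > 0\<close>)
  have Gnode: "G (node \<beta>) \<in> borel_measurable (lebesgue_on I)" for \<beta>
    using G U node by (auto simp: Linf_holomorphic_on_def intro: Linf_space_measurable)
  show b_le: "AE x in lebesgue_on I. \<bar>b j x\<bar> \<le> B" for j
  proof -
    have "AE x in lebesgue_on I. norm (G (node (fst j)) x) \<le> B"
      using bound[OF node] Linf_norm_le_iff[OF Gnode] by blast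
    then show ?thesis
    proof eventually_elim
      case (elim x)
      then show ?case
        using abs_Re_le_cmod[of "G (node (fst j)) x"] abs_Im_le_cmod[of "G (node (fst j)) x"]
        by (auto simp: b_def)
    qed
  qed
  have "b j \<in> borel_measurable (lebesgue_on I)" for j
    unfolding b_def using Gnode by (cases "snd j") auto
  then show "b j \<in> Linf_space I" for j
    unfolding Linf_space_iff real_norm_def using b_le by blast
  fix z assume z: "\<And>i. norm (z $ i - p $ i) \<le> R / 4"
  \<comment> \<open>The signs come from
    \<open>Re (w * v) = Re w * Re v - Im w * Im v\<close>.\<close>
  define c where "c j = (if snd j then Re (tensor_weight N p R UNIV z (fst j))
      else - Im (tensor_weight N p R UNIV z (fst j)))" for j
  have "\<bar>c j\<bar> \<le> 2 ^ CARD('m)" for j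
    using norm_tensor_weight_le[of UNIV z p R N "fst j"] z \<open>R > 0\<close>
      abs_Re_le_cmod[of "tensor_weight N p R UNIV z (fst j)"]
      abs_Im_le_cmod[of "tensor_weight N p R UNIV z (fst j)"]
    by (auto simp: c_def)
  moreover have "(\<Sum>j\<in>PiE UNIV (\<lambda>_. {..<N}) \<times> UNIV. c j * b j x)
      = (\<Sum>\<beta>\<in>PiE UNIV (\<lambda>_. {..<N}). \<Sum>s\<in>UNIV. c (\<beta>, s) * b (\<beta>, s) x)" for x
    by (simp add: sum.cartesian_product)
  then have "(\<Sum>j\<in>PiE UNIV (\<lambda>_. {..<N}) \<times> UNIV. c j * b j x)
      = Re (\<Sum>\<beta>\<in>PiE UNIV (\<lambda>_. {..<N}). tensor_weight N p R UNIV z \<beta> * G (node \<beta>) x)" for x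
    by (simp add: UNIV_bool c_def b_def algebra_simps)
  then have "AE x in lebesgue_on I. \<bar>Re (G z x) - (\<Sum>j\<in>PiE UNIV (\<lambda>_. {..<N}) \<times> UNIV. c j * b j x)\<bar>
        \<le> 6 * (2 ^ CARD('m) - 1) * B * (1/2) ^ N"
    using Linf_interp_error[OF G I U \<open>R > 0\<close> bound z, of N] by (simp add: node_def)
  ultimately show "\<exists>c. (\<forall>j. \<bar>c j\<bar> \<le> 2 ^ CARD('m)) \<and>
      (AE x in lebesgue_on I. \<bar>Re (G z x) - (\<Sum>j\<in>PiE UNIV (\<lambda>_. {..<N}) \<times> UNIV. c j * b j x)\<bar>
        \<le> 6 * (2 ^ CARD('m) - 1) * B * (1/2) ^ N)"
    by blast
qed

text \<open>By compactness, finitely many of the local approximation regions cover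
  \<open>closure W\<close>. The local bases at their centres are concatenated, and each parameter
  uses only the block of one centre whose region contains it.\<close>

lemma exp_approximable_holomorphic_family:
  fixes W :: "(real^'m) set" and g :: "real^'m \<Rightarrow> real \<Rightarrow> real"
    and G :: "complex^'m \<Rightarrow> real \<Rightarrow> complex"
  assumes I: "I \<in> lmeasurable" and W_bounded: "bounded W"
    and U_open: "open U" and U_contains: "cvec ` closure W \<subseteq> U"
    and G: "Linf_holomorphic_on I G U"
    and G_bounded: "\<forall>K. compact K \<and> K \<subseteq> U \<longrightarrow> (\<exists>B::real. \<forall>z\<in>K. Linf_norm I (G z) \<le> ereal B)"
    and G_extends: "\<forall>\<omega>\<in>W. AE x in lebesgue_on I. G (cvec \<omega>) x = complex_of_real (g \<omega> x)"
  shows "exp_approximable I CARD('m) (g ` W)"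
proof -
  have "\<forall>w\<in>closure W. \<exists>R. R > 0 \<and> polydisc (cvec w) R \<subseteq> U"
    using open_contains_polydisc[OF U_open] U_contains by (metis image_subset_iff)
  then obtain R where R: "\<And>w. w \<in> closure W \<Longrightarrow> R w > 0 \<and> polydisc (cvec w) (R w) \<subseteq> U"
    unfolding bchoice_iff by blast
  have "\<forall>w\<in>closure W. \<exists>B. \<forall>z\<in>polydisc (cvec w) (R w). Linf_norm I (G z) \<le> ereal B"
    using G_bounded compact_polydisc R by blast
  then obtain B where B: "\<And>w z. w \<in> closure W \<Longrightarrow> z \<in> polydisc (cvec w) (R w) \<Longrightarrow> Linf_norm I (G z) \<le> ereal (B w)"
    unfolding bchoice_iff by blast
  \<comment> \<open>The real points of the open polydisc of radius \<open>R w / 4\<close>, inside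
    which the local approximation around \<open>w\<close> is valid.\<close>
  define V where "V w = {v :: real^'m. \<forall>i. \<bar>v $ i - w $ i\<bar> < R w / 4}" for w
  have "open (V w)" for w
    unfolding V_def Collect_all_eq by (intro open_INT ballI open_Collect_less continuous_intros) simp
  moreover have "closure W \<subseteq> (\<Union>w\<in>closure W. V w)"
    using R by (force simp: V_def)
  moreover have "compact (closure W)"
    using W_bounded by (simp add: compact_closure)
  ultimately obtain T where T: "T \<subseteq> closure W" "finite T" "closure W \<subseteq> (\<Union>w\<in>T. V w)"
    using compactE_image[of "closure W" "closure W" V] by metis
  \<comment> \<open>One number that dominates, for all centres in \<open>T\<close>, the basis
    functions, the coefficients and the error constants.\<close>
  define M where "M = nat \<lceil>6 * 2 ^ CARD('m) * (1 + (\<Sum>w\<in>T. \<bar>B w\<bar>))\<rceil>"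
  \<comment> \<open>Two real functions per node for each centre in \<open>T\<close>; the
    \<open>+ 1\<close> keeps \<open>K\<close> positive whatever \<open>T\<close> is.\<close>
  define K where "K = 2 * card T + 1"
  have M: "B w \<le> real M" "2 ^ CARD('m) \<le> real M" "6 * (2 ^ CARD('m) - 1) * B w \<le> real M"
    if "w \<in> T" for w
  proof -
    define S where "S = (\<Sum>w\<in>T. \<bar>B w\<bar>)"
    define q :: real where "q = 2 ^ CARD('m)"
    have "q \<ge> 1"
      by (simp add: q_def)
    have "\<bar>B w\<bar> \<le> S"
      unfolding S_def using that \<open>finite T\<close> by (intro member_le_sum) auto
    have "6 * q * (1 + S) \<le> real M"
      by (simp add: M_def S_def q_def real_nat_ceiling_ge)
    moreover have "q * S \<ge> 1 * S" "(q - 1) * B w \<le> (q - 1) * S"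
      using \<open>q \<ge> 1\<close> \<open>\<bar>B w\<bar> \<le> S\<close> by (intro mult_right_mono mult_left_mono; simp)+
    moreover have "S \<ge> 0" "B w \<le> S"
      using \<open>\<bar>B w\<bar> \<le> S\<close> by auto
    ultimately show "B w \<le> real M" "2 ^ CARD('m) \<le> real M" "6 * (2 ^ CARD('m) - 1) * B w \<le> real M"
      using \<open>q \<ge> 1\<close> unfolding q_def[symmetric] by (simp_all add: algebra_simps)
  qed
  show ?thesis
    unfolding exp_approximable_def
  proof (rule exI[of _ M], rule exI[of _ K], intro conjI allI)
    show "0 < K" by (simp add: K_def)
    fix N :: nat
    define J where "J = PiE UNIV (\<lambda>_ :: 'm. {..<N}) \<times> (UNIV :: bool set)"
    have "finite J"
      unfolding J_def by (intro finite_cartesian_product finite_PiE) auto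
    have card_J: "card J = N ^ CARD('m) * 2"
      by (simp add: J_def card_PiE card_cartesian_product)
    have "\<forall>w\<in>T. \<exists>b :: ('m \<Rightarrow> nat) \<times> bool \<Rightarrow> real \<Rightarrow> real. (\<forall>j. b j \<in> Linf_space I \<and>
        (AE x in lebesgue_on I. \<bar>b j x\<bar> \<le> B w)) \<and>
        (\<forall>z. (\<forall>i. norm (z $ i - cvec w $ i) \<le> R w / 4) \<longrightarrow> (\<exists>c. (\<forall>j. \<bar>c j\<bar> \<le> 2 ^ CARD('m)) \<and>
          (AE x in lebesgue_on I. \<bar>Re (G z x) - (\<Sum>j\<in>J. c j * b j x)\<bar>
            \<le> 6 * (2 ^ CARD('m) - 1) * B w * (1/2) ^ N)))"
    proof
      fix w assume "w \<in> T"
      then have w: "w \<in> closure W"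
        using T by blast
      obtain b :: "('m \<Rightarrow> nat) \<times> bool \<Rightarrow> real \<Rightarrow> real"
        where "\<And>j. b j \<in> Linf_space I" and "\<And>j. AE x in lebesgue_on I. \<bar>b j x\<bar> \<le> B w"
          and "\<And>z. (\<And>i. norm (z $ i - cvec w $ i) \<le> R w / 4) \<Longrightarrow> \<exists>c. (\<forall>j. \<bar>c j\<bar> \<le> 2 ^ CARD('m)) \<and>
            (AE x in lebesgue_on I. \<bar>Re (G z x) - (\<Sum>j\<in>J. c j * b j x)\<bar>
              \<le> 6 * (2 ^ CARD('m) - 1) * B w * (1/2) ^ N)"
        using local_approximation[where N = N, OF G I conjunct2[OF R[OF w]] conjunct1[OF R[OF w]] B[OF w]]
        unfolding J_def by blast
      then show "\<exists>b :: ('m \<Rightarrow> nat) \<times> bool \<Rightarrow> real \<Rightarrow> real. (\<forall>j. b j \<in> Linf_space I \<and>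
          (AE x in lebesgue_on I. \<bar>b j x\<bar> \<le> B w)) \<and>
          (\<forall>z. (\<forall>i. norm (z $ i - cvec w $ i) \<le> R w / 4) \<longrightarrow> (\<exists>c. (\<forall>j. \<bar>c j\<bar> \<le> 2 ^ CARD('m)) \<and>
            (AE x in lebesgue_on I. \<bar>Re (G z x) - (\<Sum>j\<in>J. c j * b j x)\<bar>
              \<le> 6 * (2 ^ CARD('m) - 1) * B w * (1/2) ^ N)))"
        by (intro exI[of _ b]) simp
    qed
    then obtain b where b: "\<And>w j. w \<in> T \<Longrightarrow> b w j \<in> Linf_space I"
      and b_le: "\<And>w j. w \<in> T \<Longrightarrow> AE x in lebesgue_on I. \<bar>b w j x\<bar> \<le> B w"
      and approx: "\<And>w z. w \<in> T \<Longrightarrow> \<forall>i. norm (z $ i - cvec w $ i) \<le> R w / 4 \<Longrightarrow>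
          \<exists>c. (\<forall>j. \<bar>c j\<bar> \<le> 2 ^ CARD('m)) \<and> (AE x in lebesgue_on I.
            \<bar>Re (G z x) - (\<Sum>j\<in>J. c j * b w j x)\<bar> \<le> 6 * (2 ^ CARD('m) - 1) * B w * (1/2) ^ N)"
      unfolding bchoice_iff by blast
    define D where "D = card (T \<times> J)"
    have "D \<le> K * N ^ CARD('m)"
      by (simp add: D_def card_cartesian_product card_J K_def)
    obtain h where h: "bij_betw h {0..<D} (T \<times> J)"
      using ex_bij_betw_nat_finite[of "T \<times> J"] \<open>finite T\<close> \<open>finite J\<close> unfolding D_def by blast
    have hT: "fst (h i) \<in> T" if "i < D" for i
      using bij_betwE[OF h] that by (auto simp: mem_Times_iff)
    \<comment> \<open>The bijection \<open>h\<close> lists all pairs of a centre and a local index;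
      positions from \<open>D\<close> up to \<open>K * N ^ CARD('m)\<close> are filled with
      zeros.\<close>
    define b' where "b' i = (if i < D then b (fst (h i)) (snd (h i)) else (\<lambda>x. 0))" for i
    show "\<exists>b. (\<forall>i<K * N ^ CARD('m). b i \<in> Linf_space I \<and> (AE x in lebesgue_on I. \<bar>b i x\<bar> \<le> real M)) \<and>
      (\<forall>f\<in>g ` W. \<exists>c. (\<forall>i<K * N ^ CARD('m). \<bar>c i\<bar> \<le> real M) \<and>
        (AE x in lebesgue_on I. \<bar>f x - (\<Sum>i<K * N ^ CARD('m). c i * b i x)\<bar> \<le> real M * (1/2) ^ N))"
    proof (intro exI[of _ b'] conjI allI impI ballI)
      fix i
      show "b' i \<in> Linf_space I"
        by (simp add: b'_def b hT)
      show "AE x in lebesgue_on I. \<bar>b' i x\<bar> \<le> real M"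
      proof (cases "i < D")
        case True
        show ?thesis
          using b_le[OF hT[OF True], of "snd (h i)"]
          by eventually_elim (use M(1)[OF hT[OF True]] True in \<open>simp add: b'_def\<close>)
      qed (simp add: b'_def)
    next
      fix f assume "f \<in> g ` W"
      then obtain \<omega> where \<omega>: "\<omega> \<in> W" "f = g \<omega>"
        by blast
      then obtain w where w: "w \<in> T" "\<omega> \<in> V w"
        using T(3) closure_subset by blast
      have "\<forall>i. norm (cvec \<omega> $ i - cvec w $ i) \<le> R w / 4"
        using w(2) by (auto simp: V_def cvec_def less_imp_le simp flip: of_real_diff)
      then obtain c where c: "\<And>j. \<bar>c j\<bar> \<le> 2 ^ CARD('m)"
        and AE: "AE x in lebesgue_on I.
            \<bar>Re (G (cvec \<omega>) x) - (\<Sum>j\<in>J. c j * b w j x)\<bar> \<le> 6 * (2 ^ CARD('m) - 1) * B w * (1/2) ^ N"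
        using approx[OF w(1)] by blast
      \<comment> \<open>Only the block belonging to the chosen centre \<open>w\<close> receives
        nonzero coefficients.\<close>
      define c' where "c' i = (if i < D \<and> fst (h i) = w then c (snd (h i)) else 0)" for i
      have "\<bar>c' i\<bar> \<le> real M" for i
        using order_trans[OF c M(2)[OF w(1)]] by (simp add: c'_def)
      moreover have eq: "(\<Sum>i<K * N ^ CARD('m). c' i * b' i x) = (\<Sum>j\<in>J. c j * b w j x)" for x
      proof -
        define t where "t p = (if fst p = w then c (snd p) * b w (snd p) x else 0)" for p
        have "(\<Sum>i<K * N ^ CARD('m). c' i * b' i x) = (\<Sum>i\<in>{0..<D}. t (h i))"
          using \<open>D \<le> K * N ^ CARD('m)\<close>
          by (intro sum.mono_neutral_cong_right) (auto simp: c'_def b'_def t_def)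
        also have "\<dots> = (\<Sum>p\<in>T \<times> J. t p)"
          by (rule sum.reindex_bij_betw[OF h])
        also have "\<dots> = (\<Sum>v\<in>T. \<Sum>j\<in>J. t (v, j))"
          by (simp add: sum.cartesian_product)
        also have "\<dots> = (\<Sum>v\<in>T. if v = w then \<Sum>j\<in>J. c j * b w j x else 0)"
          by (intro sum.cong) (auto simp: t_def)
        also have "\<dots> = (\<Sum>j\<in>J. c j * b w j x)"
          using w(1) \<open>finite T\<close> by simp
        finally show ?thesis .
      qed
      moreover have "AE x in lebesgue_on I. \<bar>f x - (\<Sum>j\<in>J. c j * b w j x)\<bar> \<le> real M * (1/2) ^ N"
        using AE bspec[OF G_extends \<omega>(1)]
      proof eventually_elim
        case (elim x)
        have "6 * (2 ^ CARD('m) - 1) * B w * (1/2) ^ N \<le> real M * (1/2) ^ N"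
          using M(3)[OF w(1)] by (rule mult_right_mono) simp
        with elim(1) show ?case
          unfolding elim(2) Re_complex_of_real \<omega>(2) by (rule order_trans)
      qed
      ultimately show "\<exists>c. (\<forall>i<K * N ^ CARD('m). \<bar>c i\<bar> \<le> real M) \<and>
        (AE x in lebesgue_on I. \<bar>f x - (\<Sum>i<K * N ^ CARD('m). c i * b' i x)\<bar> \<le> real M * (1/2) ^ N)"
        by (intro exI[of _ c']) simp
    qed
  qed
qed

theorem theorem4p6:
  fixes W :: "(real^'m) set" and I :: "real set"
    and g :: "real^'m \<Rightarrow> real \<Rightarrow> real"
    and G :: "complex^'m \<Rightarrow> real \<Rightarrow> complex"
    and U :: "(complex^'m) set"
  assumes W_open: "open W" and W_ne: "W \<noteq> {}" and W_convex: "convex W"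
    and W_bounded: "bounded W"
    and I_interval: "is_interval I" and I_bounded: "bounded I"
    and g_Linf: "\<forall>\<omega>\<in>W. g \<omega> \<in> Linf_space I"
    and U_open: "open U"
    and U_contains: "cvec ` closure W \<subseteq> U"
    and G_holo: "Linf_holomorphic_on I G U"
    and G_bounded: "\<forall>K. compact K \<and> K \<subseteq> U \<longrightarrow> (\<exists>B::real. \<forall>z\<in>K. Linf_norm I (G z) \<le> ereal B)"
    and G_extends: "\<forall>\<omega>\<in>W. AE x in lebesgue_on I. G (cvec \<omega>) x = complex_of_real (g \<omega> x)"
  shows "\<exists>C4>0. \<exists>C5>0. \<exists>C>0. \<forall>n::nat. n \<ge> 1 \<longrightarrow>
           kolmogorov_width I n (g ` W)
             \<le> ereal (C * exp (- C4 * real n powr (1 / real CARD('m)))) \<and>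
           entropy_number I n (B1 I (g ` W))
             \<le> ereal (C * exp (- C5 * real n powr (1 / (real CARD('m) + 1))))"
proof -
  have I: "I \<in> lmeasurable"
    using I_interval I_bounded by (intro measurable_convex is_interval_convex)
  have F: "exp_approximable I CARD('m) (g ` W)"
    by (rule exp_approximable_holomorphic_family[OF I W_bounded U_open U_contains G_holo G_bounded G_extends])
  have gW: "g ` W \<subseteq> Linf_space I"
    using g_Linf by blast
  obtain a C where a: "a > 0" "C > 0"
    and width: "\<And>n. kolmogorov_width I n (g ` W) \<le> ereal (C * exp (- a * real n powr (1 / real CARD('m))))"
    using kolmogorov_width_exp_decay[OF F gW] by auto
  obtain a' C' where a': "a' > 0" "C' > 0"
    and entropy: "\<And>n. entropy_number I n (B1 I (g ` W))
        \<le> ereal (C' * exp (- a' * real n powr (1 / (real CARD('m) + 1))))"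
    using entropy_number_exp_decay[OF F gW] by auto
  \<comment> \<open>The sum of the two constants serves both estimates, while the rates remain
    separate.\<close>
  have "C * t \<le> (C + C') * t" "C' * t \<le> (C + C') * t" if "t \<ge> 0" for t
    using that a a' by (simp_all add: algebra_simps)
  then have "kolmogorov_width I n (g ` W)
        \<le> ereal ((C + C') * exp (- a * real n powr (1 / real CARD('m)))) \<and>
      entropy_number I n (B1 I (g ` W))
        \<le> ereal ((C + C') * exp (- a' * real n powr (1 / (real CARD('m) + 1))))" for n
    by (intro conjI order_trans[OF width] order_trans[OF entropy]) simp_all
  then show ?thesis
    using a a' by (intro exI[of _ a] exI[of _ a'] exI[of _ "C + C'"] conjI) auto
qed

end
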